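(* Let $(M,c_M,J^M)$ be a complex analytic almost Hermitian manifold. If $\dim M\geq4$ let $D^M$ be the Weyl connection of $(M,c_M,J^M)$; if $\dim M=2$ let $D^M$ be any Weyl connection on $(M,c_M)$. Let $\varphi:(M,c_M)\to N$ be a horizontally conformal submersion with degenerate fibres such that $\ker\mathrm d\varphi$ contains $\mathscr F$ or $\widetilde{\mathscr F}$, where $\mathscr F$, $\widetilde{\mathscr F}$ are the eigendistributions of $J^M$. Then $\varphi:(M,c_M,D^M)\to(N,D^N)$ is a harmonic map with respect to any connection $D^N$ on $N$, and $\varphi:(M,c_M,D^M)\to(N,c_N,D^N)$ is a harmonic morphism with respect to any structure of Weyl space on $N$. Conversely, if $\dim M\geq4$, $J^M$ is integrable and $D$ is a Weyl connection on $(M,c_M)$ such that the foliations $\mathscr F$ and $\widetilde{\mathscr F}$ are locally defined by harmonic maps, with respect to $c_M$, $D$, then $D$ is the Weyl connection of $(M,c_M,J^M)$.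
   Context: Category: complex analytic (everything is holomorphic; $TM$ is the holomorphic tangent bundle). Conformal manifold $(M^m,c)$: a reduction of the frame bundle to $CO(m,\mathbb C)=\{a: a^Ta=\rho_m(a)I_m,\ \rho_m(a)\ne0\}$; equivalently a class of local holomorphic metrics $g$ (local representatives) differing by nowhere zero function factors. A Weyl connection on $(M,c)$ is a torsion free linear connection preserving $c$; a Weyl space is a conformal manifold with a Weyl connection. Almost Hermitian manifold $(M,c,J)$: $J$ a holomorphic endomorphism field of $TM$ with $J^2=-\mathrm{Id}$ and $c(JX,JY)=c(X,Y)$; its eigendistributions are the $\pm\mathrm i$ eigenbundles of $J$ in $TM$; $J$ is integrable if both eigendistributions are integrable. If $\dim M\ge4$, the Weyl connection of $(M,c,J)$ is the unique Weyl connection $D$ on $(M,c)$ with $\operatorname{trace}_c(DJ)=0$. Horizontally (weakly) conformal: $g^{-1}(\varphi^*\alpha,\varphi^*\beta)=\Lambda\,h^{-1}(\alpha,\beta)$ for all covectors $\alpha,\beta$ on $N$, with $g,h$ local representatives of the conformal structures and $\Lambda$ a function. For a submersion with degenerate fibres this is with $\Lambda=0$, i.e. $(\ker\mathrm d\varphi)^\perp\subseteq\ker\mathrm d\varphi$, a condition not involving a conformal structure on $N$. Harmonic map $\varphi:(M,c_M,D^M)\to(N,D^N)$: $\operatorname{trace}_{c_M}(D\,\mathrm d\varphi)=0$, where $D$ is the connection on $\varphi^*(TN)\otimes T^*M$ induced by $D^M$, $D^N$ and $\varphi$. Harmonic morphism between Weyl spaces: a map which pulls back local harmonic functions to harmonic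 functions. A foliation is locally defined by harmonic maps, with respect to $c_M$, $D$, if locally it is the kernel of the differential of a submersion onto a manifold endowed with a connection $D'$ which is harmonic with respect to $c_M$, $D$, $D'$. *)

theory Defs
  imports "HOL-Analysis.Analysis"
begin

section \<open>Holomorphic functions of several variables\<close>

text \<open>Complex Frechet differentiability: the derivative at each point is complex linear.\<close>
definition holo_fun :: "(complex^'m \<Rightarrow> complex) \<Rightarrow> (complex^'m) set \<Rightarrow> bool" where
  "holo_fun f S \<longleftrightarrow>
     open S \<and> (\<forall>z\<in>S. \<exists>a::complex^'m. (f has_derivative (\<lambda>v. \<Sum>i\<in>UNIV. a $ i * v $ i)) (at z))"

definition holo_vec :: "(complex^'m \<Rightarrow> complex^'n) \<Rightarrow> (complex^'m) set \<Rightarrow> bool" where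
  "holo_vec f S \<longleftrightarrow> (\<forall>i. holo_fun (\<lambda>z. f z $ i) S)"

definition holo_mat :: "(complex^'m \<Rightarrow> complex^'k^'n) \<Rightarrow> (complex^'m) set \<Rightarrow> bool" where
  "holo_mat f S \<longleftrightarrow> (\<forall>i j. holo_fun (\<lambda>z. f z $ i $ j) S)"

definition cpartial :: "'m \<Rightarrow> (complex^'m \<Rightarrow> complex) \<Rightarrow> complex^'m \<Rightarrow> complex" where
  "cpartial i f z = deriv (\<lambda>t. f (z + axis i t)) 0"

definition jac :: "(complex^'m \<Rightarrow> complex^'n) \<Rightarrow> complex^'m \<Rightarrow> complex^'m^'n" where
  "jac f z = (\<chi> a i. cpartial i (\<lambda>w. f w $ a) z)"


section \<open>Complex manifolds\<close>

type_synonym ('a, 'm) chart = "'a set \<times> ('a \<Rightarrow> complex^'m)"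

record ('a, 'm) cmfd =
  mtop :: "'a topology"
  atlas :: "('a, 'm::finite) chart set"

abbreviation pts :: "('a, 'm::finite) cmfd \<Rightarrow> 'a set" where
  "pts M \<equiv> topspace (mtop M)"

abbreviation (input) cdom :: "('a, 'm::finite) chart \<Rightarrow> 'a set" where "cdom \<equiv> fst"
abbreviation (input) coord :: "('a, 'm::finite) chart \<Rightarrow> 'a \<Rightarrow> complex^'m" where "coord \<equiv> snd"

definition cinv :: "('a, 'm::finite) chart \<Rightarrow> complex^'m \<Rightarrow> 'a" where
  "cinv \<kappa> = inv_into (cdom \<kappa>) (coord \<kappa>)"

definition trans_map :: "('a, 'm::finite) chart \<Rightarrow> ('a, 'm::finite) chart \<Rightarrow> complex^'m \<Rightarrow> complex^'m" where
  "trans_map \<kappa> \<kappa>' = coord \<kappa>' \<circ> cinv \<kappa>"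

definition is_chart :: "'a topology \<Rightarrow> ('a, 'm::finite) chart \<Rightarrow> bool" where
  "is_chart T \<kappa> \<longleftrightarrow>
     openin T (cdom \<kappa>) \<and> open (coord \<kappa> ` cdom \<kappa>) \<and>
     homeomorphic_map (subtopology T (cdom \<kappa>)) (top_of_set (coord \<kappa> ` cdom \<kappa>)) (coord \<kappa>)"

definition compatible :: "('a, 'm::finite) chart \<Rightarrow> ('a, 'm::finite) chart \<Rightarrow> bool" where
  "compatible \<kappa> \<kappa>' \<longleftrightarrow>
     holo_vec (trans_map \<kappa> \<kappa>') (coord \<kappa> ` (cdom \<kappa> \<inter> cdom \<kappa>')) \<and>
     holo_vec (trans_map \<kappa>' \<kappa>) (coord \<kappa>' ` (cdom \<kappa> \<inter> cdom \<kappa>'))"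

text \<open>The atlas need not be maximal; the dimension is \<^term>\<open>CARD('m)\<close>.\<close>
definition complex_manifold :: "('a, 'm::finite) cmfd \<Rightarrow> bool" where
  "complex_manifold M \<longleftrightarrow>
     Hausdorff_space (mtop M) \<and> second_countable (mtop M) \<and>
     pts M = (\<Union>\<kappa>\<in>atlas M. cdom \<kappa>) \<and>
     (\<forall>\<kappa>\<in>atlas M. is_chart (mtop M) \<kappa>) \<and>
     (\<forall>\<kappa>\<in>atlas M. \<forall>\<kappa>'\<in>atlas M. compatible \<kappa> \<kappa>')"

definition coord_rep :: "('a, 'm::finite) chart \<Rightarrow> ('b, 'n::finite) chart \<Rightarrow> ('a \<Rightarrow> 'b) \<Rightarrow> complex^'m \<Rightarrow> complex^'n" where
  "coord_rep \<kappa> \<mu> \<phi> = coord \<mu> \<circ> \<phi> \<circ> cinv \<kappa>"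

text \<open>The coordinates of those points of \<open>W\<close> that \<open>\<phi>\<close> maps into the domain of \<open>\<mu>\<close>.\<close>
definition rep_dom :: "'a set \<Rightarrow> ('a, 'm::finite) chart \<Rightarrow> ('b, 'n::finite) chart \<Rightarrow> ('a \<Rightarrow> 'b) \<Rightarrow> (complex^'m) set" where
  "rep_dom W \<kappa> \<mu> \<phi> = coord \<kappa> ` {p \<in> W \<inter> cdom \<kappa>. \<phi> p \<in> cdom \<mu>}"

definition holo_map :: "'a set \<Rightarrow> ('a, 'm::finite) cmfd \<Rightarrow> ('b, 'n::finite) cmfd \<Rightarrow> ('a \<Rightarrow> 'b) \<Rightarrow> bool" where
  "holo_map W M N \<phi> \<longleftrightarrow>
     openin (mtop M) W \<and> continuous_map (subtopology (mtop M) W) (mtop N) \<phi> \<and>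
     (\<forall>\<kappa>\<in>atlas M. \<forall>\<mu>\<in>atlas N. holo_vec (coord_rep \<kappa> \<mu> \<phi>) (rep_dom W \<kappa> \<mu> \<phi>))"

definition submersion :: "'a set \<Rightarrow> ('a, 'm::finite) cmfd \<Rightarrow> ('b, 'n::finite) cmfd \<Rightarrow> ('a \<Rightarrow> 'b) \<Rightarrow> bool" where
  "submersion W M N \<phi> \<longleftrightarrow> holo_map W M N \<phi> \<and>
     (\<forall>\<kappa>\<in>atlas M. \<forall>\<mu>\<in>atlas N. \<forall>z\<in>rep_dom W \<kappa> \<mu> \<phi>. surj ((*v) (jac (coord_rep \<kappa> \<mu> \<phi>) z)))"

definition ker_d :: "('a, 'm::finite) chart \<Rightarrow> ('b, 'n::finite) chart \<Rightarrow> ('a \<Rightarrow> 'b) \<Rightarrow> complex^'m \<Rightarrow> (complex^'m) set" where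
  "ker_d \<kappa> \<mu> \<phi> z = {v. jac (coord_rep \<kappa> \<mu> \<phi>) z *v v = 0}"


section \<open>Tensor fields, connections and distributions in charts\<close>

text \<open>
  A geometric object is given by its components in each chart of the atlas, as functions of the
  coordinates, subject to the transformation law of the object; values at coordinates outside
  its domain are irrelevant.
\<close>
type_synonym ('a, 'm) mat_field = "('a, 'm::finite) chart \<Rightarrow> complex^'m \<Rightarrow> complex^'m^'m"
type_synonym ('a, 'm) distrib = "('a, 'm::finite) chart \<Rightarrow> complex^'m \<Rightarrow> (complex^'m) set"

text \<open>\<open>D \<kappa> z k i j\<close> is the Christoffel symbol \<open>\<Gamma>\<^sup>k\<^sub>i\<^sub>j\<close>, where
  \<open>D\<^sub>i \<partial>\<^sub>j = (\<Sum>k. \<Gamma>\<^sup>k\<^sub>i\<^sub>j \<partial>\<^sub>k)\<close>.\<close>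
type_synonym ('a, 'm) conn = "('a, 'm::finite) chart \<Rightarrow> complex^'m \<Rightarrow> 'm \<Rightarrow> 'm \<Rightarrow> 'm \<Rightarrow> complex"

definition linear_connection :: "('a, 'm::finite) cmfd \<Rightarrow> ('a, 'm::finite) conn \<Rightarrow> bool" where
  "linear_connection M D \<longleftrightarrow>
     (\<forall>\<kappa>\<in>atlas M. \<forall>k i j. holo_fun (\<lambda>z. D \<kappa> z k i j) (coord \<kappa> ` cdom \<kappa>)) \<and>
     (\<forall>\<kappa>\<in>atlas M. \<forall>\<kappa>'\<in>atlas M. \<forall>z \<in> coord \<kappa> ` (cdom \<kappa> \<inter> cdom \<kappa>'). \<forall>c i j.
        let \<tau> = trans_map \<kappa> \<kappa>'; A = jac \<tau> z in
        (\<Sum>k\<in>UNIV. A $ c $ k * D \<kappa> z k i j) =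
        cpartial i (cpartial j (\<lambda>w. \<tau> w $ c)) z +
        (\<Sum>a\<in>UNIV. \<Sum>b\<in>UNIV. D \<kappa>' (\<tau> z) c a b * A $ a $ i * A $ b $ j))"

definition torsion_free :: "('a, 'm::finite) cmfd \<Rightarrow> ('a, 'm::finite) conn \<Rightarrow> bool" where
  "torsion_free M D \<longleftrightarrow>
     (\<forall>\<kappa>\<in>atlas M. \<forall>z \<in> coord \<kappa> ` cdom \<kappa>. \<forall>k i j. D \<kappa> z k i j = D \<kappa> z k j i)"

definition endo_field :: "('a, 'm::finite) cmfd \<Rightarrow> ('a, 'm::finite) mat_field \<Rightarrow> bool" where
  "endo_field M J \<longleftrightarrow>
     (\<forall>\<kappa>\<in>atlas M. holo_mat (J \<kappa>) (coord \<kappa> ` cdom \<kappa>)) \<and>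
     (\<forall>\<kappa>\<in>atlas M. \<forall>\<kappa>'\<in>atlas M. \<forall>z \<in> coord \<kappa> ` (cdom \<kappa> \<inter> cdom \<kappa>').
        jac (trans_map \<kappa> \<kappa>') z ** J \<kappa> z = J \<kappa>' (trans_map \<kappa> \<kappa>' z) ** jac (trans_map \<kappa> \<kappa>') z)"

definition local_metric :: "('a, 'm::finite) cmfd \<Rightarrow> 'a set \<Rightarrow> ('a, 'm::finite) mat_field \<Rightarrow> bool" where
  "local_metric M W g \<longleftrightarrow> openin (mtop M) W \<and>
     (\<forall>\<kappa>\<in>atlas M. holo_mat (g \<kappa>) (coord \<kappa> ` (cdom \<kappa> \<inter> W)) \<and>
        (\<forall>z \<in> coord \<kappa> ` (cdom \<kappa> \<inter> W). transpose (g \<kappa> z) = g \<kappa> z \<and> invertible (g \<kappa> z))) \<and>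
     (\<forall>\<kappa>\<in>atlas M. \<forall>\<kappa>'\<in>atlas M. \<forall>z \<in> coord \<kappa> ` (cdom \<kappa> \<inter> cdom \<kappa>' \<inter> W).
        let A = jac (trans_map \<kappa> \<kappa>') z in
        g \<kappa> z = transpose A ** g \<kappa>' (trans_map \<kappa> \<kappa>' z) ** A)"

definition bil :: "complex^'m^'m \<Rightarrow> complex^'m \<Rightarrow> complex^'m \<Rightarrow> complex" where
  "bil G v w = (\<Sum>i\<in>UNIV. \<Sum>j\<in>UNIV. G $ i $ j * v $ i * w $ j)"

definition perp :: "complex^'m^'m \<Rightarrow> (complex^'m) set \<Rightarrow> (complex^'m) set" where
  "perp G S = {v. \<forall>w\<in>S. bil G v w = 0}"


section \<open>Conformal manifolds and Weyl connections\<close>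

text \<open>
  A conformal structure is given by a family of local representatives \<open>(W, g)\<close> covering the
  manifold; like an atlas, the family is not required to be maximal. Since the metrics are
  nondegenerate, the pointwise factor \<open>f\<close> is unique, hence independent of the chart and
  holomorphic in the point.
\<close>
type_synonym ('a, 'm) conf = "('a set \<times> ('a, 'm::finite) mat_field) set"

definition conformal_manifold :: "('a, 'm::finite) cmfd \<Rightarrow> ('a, 'm::finite) conf \<Rightarrow> bool" where
  "conformal_manifold M c \<longleftrightarrow> complex_manifold M \<and>
     (\<forall>(W, g)\<in>c. local_metric M W g) \<and>
     (\<Union>(W, g)\<in>c. W) = pts M \<and>
     (\<forall>(W, g)\<in>c. \<forall>(W', g')\<in>c. \<forall>\<kappa>\<in>atlas M. \<forall>z \<in> coord \<kappa> ` (cdom \<kappa> \<inter> W \<inter> W').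
        \<exists>f. f \<noteq> 0 \<and> (\<forall>i j. g \<kappa> z $ i $ j = f * g' \<kappa> z $ i $ j))"

text \<open>\<open>D\<^sub>k g\<^sub>i\<^sub>j\<close>\<close>
definition cov_deriv_metric ::
    "('m::finite \<Rightarrow> 'm \<Rightarrow> 'm \<Rightarrow> complex) \<Rightarrow> (complex^'m \<Rightarrow> complex^'m^'m) \<Rightarrow> complex^'m \<Rightarrow> 'm \<Rightarrow> 'm \<Rightarrow> 'm \<Rightarrow> complex" where
  "cov_deriv_metric \<Gamma> g z k i j =
     cpartial k (\<lambda>w. g w $ i $ j) z
     - (\<Sum>l\<in>UNIV. \<Gamma> l k i * g z $ l $ j) - (\<Sum>l\<in>UNIV. \<Gamma> l k j * g z $ i $ l)"

text \<open>
  \<open>D\<close> preserves \<open>c\<close> iff \<open>D g = \<alpha> \<otimes> g\<close> with a one-form \<open>\<alpha>\<close> for each local representative \<open>g\<close>;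
  \<open>a\<close> below is the component \<open>\<alpha>\<^sub>k\<close>, uniquely determined as \<open>g\<close> is nondegenerate.
\<close>
definition preserves_conf :: "('a, 'm::finite) cmfd \<Rightarrow> ('a, 'm::finite) conf \<Rightarrow> ('a, 'm::finite) conn \<Rightarrow> bool" where
  "preserves_conf M c D \<longleftrightarrow>
     (\<forall>(W, g)\<in>c. \<forall>\<kappa>\<in>atlas M. \<forall>z \<in> coord \<kappa> ` (cdom \<kappa> \<inter> W). \<forall>k. \<exists>a. \<forall>i j.
        cov_deriv_metric (D \<kappa> z) (g \<kappa>) z k i j = a * g \<kappa> z $ i $ j)"

definition weyl_space :: "('a, 'm::finite) cmfd \<Rightarrow> ('a, 'm::finite) conf \<Rightarrow> ('a, 'm::finite) conn \<Rightarrow> bool" where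
  "weyl_space M c D \<longleftrightarrow> conformal_manifold M c \<and>
     linear_connection M D \<and> torsion_free M D \<and> preserves_conf M c D"


section \<open>Almost Hermitian manifolds\<close>

definition almost_hermitian :: "('a, 'm::finite) cmfd \<Rightarrow> ('a, 'm::finite) conf \<Rightarrow> ('a, 'm::finite) mat_field \<Rightarrow> bool" where
  "almost_hermitian M c J \<longleftrightarrow> conformal_manifold M c \<and> endo_field M J \<and>
     (\<forall>\<kappa>\<in>atlas M. \<forall>z \<in> coord \<kappa> ` cdom \<kappa>. J \<kappa> z ** J \<kappa> z = - mat 1) \<and>
     (\<forall>(W, g)\<in>c. \<forall>\<kappa>\<in>atlas M. \<forall>z \<in> coord \<kappa> ` (cdom \<kappa> \<inter> W). \<forall>v w.
        bil (g \<kappa> z) (J \<kappa> z *v v) (J \<kappa> z *v w) = bil (g \<kappa> z) v w)"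

definition eigendist :: "('a, 'm::finite) mat_field \<Rightarrow> complex \<Rightarrow> ('a, 'm::finite) distrib" where
  "eigendist J r \<kappa> z = {v. J \<kappa> z *v v = r *s v}"

text \<open>Integrability of a distribution: near each point there is a holomorphic chart \<open>\<mu>\<close> (of the maximal
  atlas) in which the leaves are the slices where the coordinates with index in \<open>S\<close> are constant.\<close>
definition integrable_distrib :: "('a, 'm::finite) cmfd \<Rightarrow> ('a, 'm::finite) distrib \<Rightarrow> bool" where
  "integrable_distrib M E \<longleftrightarrow>
     (\<forall>p\<in>pts M. \<exists>\<mu> S. is_chart (mtop M) \<mu> \<and> (\<forall>\<kappa>\<in>atlas M. compatible \<kappa> \<mu>) \<and> p \<in> cdom \<mu> \<and>
        (\<forall>\<kappa>\<in>atlas M. \<forall>z \<in> coord \<kappa> ` (cdom \<kappa> \<inter> cdom \<mu>).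
           E \<kappa> z = {v. \<forall>i\<in>S. (jac (trans_map \<kappa> \<mu>) z *v v) $ i = 0}))"

definition integrable_structure :: "('a, 'm::finite) cmfd \<Rightarrow> ('a, 'm::finite) mat_field \<Rightarrow> bool" where
  "integrable_structure M J \<longleftrightarrow>
     integrable_distrib M (eigendist J \<i>) \<and> integrable_distrib M (eigendist J (-\<i>))"

text \<open>\<open>(D\<^sub>i J)\<^sup>k\<^sub>j\<close>\<close>
definition cov_deriv_endo ::
    "('m::finite \<Rightarrow> 'm \<Rightarrow> 'm \<Rightarrow> complex) \<Rightarrow> (complex^'m \<Rightarrow> complex^'m^'m) \<Rightarrow> complex^'m \<Rightarrow> 'm \<Rightarrow> 'm \<Rightarrow> 'm \<Rightarrow> complex" where
  "cov_deriv_endo \<Gamma> J z i k j =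
     cpartial i (\<lambda>w. J w $ k $ j) z
     + (\<Sum>l\<in>UNIV. \<Gamma> k i l * J z $ l $ j) - (\<Sum>l\<in>UNIV. \<Gamma> l i j * J z $ k $ l)"

definition trace_form :: "complex^'m^'m \<Rightarrow> ('m \<Rightarrow> 'm \<Rightarrow> complex) \<Rightarrow> complex" where
  "trace_form G B = (\<Sum>i\<in>UNIV. \<Sum>j\<in>UNIV. matrix_inv G $ i $ j * B i j)"

text \<open>\<open>D\<close> is the Weyl connection of \<open>(M, c, J)\<close>; in dimension at least 4 it exists and is
  uniquely determined by this property.\<close>
definition hermitian_weyl ::
    "('a, 'm::finite) cmfd \<Rightarrow> ('a, 'm::finite) conf \<Rightarrow> ('a, 'm::finite) mat_field \<Rightarrow> ('a, 'm::finite) conn \<Rightarrow> bool" where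
  "hermitian_weyl M c J D \<longleftrightarrow> weyl_space M c D \<and>
     (\<forall>(W, g)\<in>c. \<forall>\<kappa>\<in>atlas M. \<forall>z \<in> coord \<kappa> ` (cdom \<kappa> \<inter> W). \<forall>k.
        trace_form (g \<kappa> z) (\<lambda>i j. cov_deriv_endo (D \<kappa> z) (J \<kappa>) z i k j) = 0)"


section \<open>Horizontally conformal submersions, harmonic maps and morphisms\<close>

text \<open>Horizontal conformality with factor \<open>\<Lambda> = 0\<close>, that is, \<open>(ker d\<phi>)\<^sup>\<bottom> \<subseteq> ker d\<phi>\<close>;
  no conformal structure on the codomain is involved.\<close>
definition hor_conformal_degenerate ::
    "('a, 'm::finite) cmfd \<Rightarrow> ('a, 'm::finite) conf \<Rightarrow> ('b, 'n::finite) cmfd \<Rightarrow> ('a \<Rightarrow> 'b) \<Rightarrow> bool" where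
  "hor_conformal_degenerate M c N \<phi> \<longleftrightarrow> submersion (pts M) M N \<phi> \<and>
     (\<forall>(W, g)\<in>c. \<forall>\<kappa>\<in>atlas M. \<forall>\<mu>\<in>atlas N. \<forall>z\<in>rep_dom W \<kappa> \<mu> \<phi>.
        perp (g \<kappa> z) (ker_d \<kappa> \<mu> \<phi> z) \<subseteq> ker_d \<kappa> \<mu> \<phi> z)"

definition ker_contains ::
    "('a, 'm::finite) cmfd \<Rightarrow> ('b, 'n::finite) cmfd \<Rightarrow> ('a \<Rightarrow> 'b) \<Rightarrow> ('a, 'm::finite) distrib \<Rightarrow> bool" where
  "ker_contains M N \<phi> E \<longleftrightarrow>
     (\<forall>\<kappa>\<in>atlas M. \<forall>\<mu>\<in>atlas N. \<forall>z\<in>rep_dom (pts M) \<kappa> \<mu> \<phi>. E \<kappa> z \<subseteq> ker_d \<kappa> \<mu> \<phi> z)"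

text \<open>Component \<open>a\<close> of \<open>(D d\<phi>)(\<partial>\<^sub>i, \<partial>\<^sub>j)\<close> in charts, with \<open>F\<close> the coordinate representation of
  \<open>\<phi>\<close>, and \<open>\<Gamma>\<close>, \<open>\<Gamma>'\<close> the Christoffel symbols of the domain and codomain at \<open>z\<close> and \<open>F z\<close>.\<close>
definition second_fund ::
    "('m::finite \<Rightarrow> 'm \<Rightarrow> 'm \<Rightarrow> complex) \<Rightarrow> ('n::finite \<Rightarrow> 'n \<Rightarrow> 'n \<Rightarrow> complex) \<Rightarrow>
     (complex^'m \<Rightarrow> complex^'n) \<Rightarrow> complex^'m \<Rightarrow> 'n \<Rightarrow> 'm \<Rightarrow> 'm \<Rightarrow> complex" where
  "second_fund \<Gamma> \<Gamma>' F z a i j =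
     cpartial i (cpartial j (\<lambda>w. F w $ a)) z
     - (\<Sum>k\<in>UNIV. \<Gamma> k i j * cpartial k (\<lambda>w. F w $ a) z)
     + (\<Sum>b\<in>UNIV. \<Sum>c\<in>UNIV. \<Gamma>' a b c * cpartial i (\<lambda>w. F w $ b) z * cpartial j (\<lambda>w. F w $ c) z)"

definition harmonic_map ::
    "'a set \<Rightarrow> ('a, 'm::finite) cmfd \<Rightarrow> ('a, 'm::finite) conf \<Rightarrow> ('a, 'm::finite) conn \<Rightarrow>
     ('b, 'n::finite) cmfd \<Rightarrow> ('b, 'n::finite) conn \<Rightarrow> ('a \<Rightarrow> 'b) \<Rightarrow> bool" where
  "harmonic_map U M c D N D' \<phi> \<longleftrightarrow> holo_map U M N \<phi> \<and>
     (\<forall>(W, g)\<in>c. \<forall>\<kappa>\<in>atlas M. \<forall>\<mu>\<in>atlas N. \<forall>z\<in>rep_dom (U \<inter> W) \<kappa> \<mu> \<phi>. \<forall>a.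
        let F = coord_rep \<kappa> \<mu> \<phi> in
        trace_form (g \<kappa> z) (second_fund (D \<kappa> z) (D' \<mu> (F z)) F z a) = 0)"

text \<open>Local harmonic functions, i.e. harmonic maps from the open set \<open>V\<close> to \<open>\<complex>\<close> with its
  flat connection.\<close>
definition harmonic_fun ::
    "'a set \<Rightarrow> ('a, 'm::finite) cmfd \<Rightarrow> ('a, 'm::finite) conf \<Rightarrow> ('a, 'm::finite) conn \<Rightarrow> ('a \<Rightarrow> complex) \<Rightarrow> bool" where
  "harmonic_fun V M c D f \<longleftrightarrow> openin (mtop M) V \<and>
     (\<forall>\<kappa>\<in>atlas M. holo_fun (f \<circ> cinv \<kappa>) (coord \<kappa> ` (cdom \<kappa> \<inter> V))) \<and>
     (\<forall>(W, g)\<in>c. \<forall>\<kappa>\<in>atlas M. \<forall>z \<in> coord \<kappa> ` (cdom \<kappa> \<inter> W \<inter> V).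
        let F = f \<circ> cinv \<kappa> in
        trace_form (g \<kappa> z)
          (\<lambda>i j. cpartial i (cpartial j F) z - (\<Sum>k\<in>UNIV. D \<kappa> z k i j * cpartial k F z)) = 0)"

definition harmonic_morphism ::
    "('a, 'm::finite) cmfd \<Rightarrow> ('a, 'm::finite) conf \<Rightarrow> ('a, 'm::finite) conn \<Rightarrow>
     ('b, 'n::finite) cmfd \<Rightarrow> ('b, 'n::finite) conf \<Rightarrow> ('b, 'n::finite) conn \<Rightarrow> ('a \<Rightarrow> 'b) \<Rightarrow> bool" where
  "harmonic_morphism M c D N c' D' \<phi> \<longleftrightarrow> holo_map (pts M) M N \<phi> \<and>
     (\<forall>V f. harmonic_fun V N c' D' f \<longrightarrow> harmonic_fun {p \<in> pts M. \<phi> p \<in> V} M c D (f \<circ> \<phi>))"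

text \<open>
  The type argument fixes the point type and the dimension of the manifolds \<open>N\<close> onto which the
  local submersions map. In a hypothesis, a type variable there makes the hypothesis an existential
  over all manifolds \<open>N\<close>.
\<close>
definition locally_defined_by_harmonic_maps ::
    "('b, 'n::finite) cmfd itself \<Rightarrow>
     ('a, 'm::finite) cmfd \<Rightarrow> ('a, 'm::finite) conf \<Rightarrow> ('a, 'm::finite) conn \<Rightarrow> ('a, 'm::finite) distrib \<Rightarrow> bool" where
  "locally_defined_by_harmonic_maps _ M c D E \<longleftrightarrow>
     (\<forall>p\<in>pts M. \<exists>U (N :: ('b, 'n) cmfd) D' \<phi>.
        p \<in> U \<and> complex_manifold N \<and> linear_connection N D' \<and>
        submersion U M N \<phi> \<and> \<phi> ` U = pts N \<and>
        (\<forall>\<kappa>\<in>atlas M. \<forall>\<mu>\<in>atlas N. \<forall>z\<in>rep_dom U \<kappa> \<mu> \<phi>. E \<kappa> z = ker_d \<kappa> \<mu> \<phi> z) \<and>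
        harmonic_map U M c D N D' \<phi>)"

end

theory Submission
  imports Defs "HOL-Complex_Analysis.Cauchy_Integral_Formula"
begin

text \<open>
  Let \<open>u\<close> be a holomorphic function with \<open>du\<close> vanishing on the \<open>r\<close>-eigenspaces of \<open>J\<close>, where
  \<open>r = \<plusminus>\<i>\<close>; then \<open>du \<circ> J = - r du\<close>. Differentiating this covariantly and taking the trace gives
  \<open>du (trace DJ) = - r trace (D du)\<close>, because \<open>D du\<close> is symmetric and \<open>J\<close> is skew. Moreover \<open>g\<^sup>-\<^sup>1\<close>
  vanishes on pairs of covectors of this kind, so the connection of the codomain does not contribute
  to the trace of the second fundamental form. If \<open>trace DJ = 0\<close> (automatic in dimension 2), this
  applies to the components of \<open>\<phi>\<close> and to the pull-back of a function by \<open>\<phi>\<close>. Conversely, if an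
  eigendistribution is the kernel of a harmonic \<open>d\<phi>\<close>, then it contains \<open>trace DJ\<close>; lying in both
  eigendistributions, \<open>trace DJ\<close> is zero.
\<close>

section \<open>Mixed partial derivatives of holomorphic functions\<close>

text \<open>The difference quotients in \<open>t\<close> at 0 are holomorphic in \<open>s\<close>
  and converge uniformly in \<open>s\<close> to the \<open>t\<close>-derivative. By Weierstrass'
  theorem the limit is holomorphic in \<open>s\<close> and its derivative is the limit of the
  derivatives of the quotients. At \<open>s = 0\<close> those derivatives are in turn difference
  quotients, so their limit is the other mixed derivative.\<close>

lemma separately_holomorphic_derivs:
  fixes h :: "complex \<Rightarrow> complex \<Rightarrow> complex"
  assumes "0 < R" and cont: "continuous_on (cball 0 R \<times> cball 0 R) (\<lambda>(s, t). h s t)"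
    and hs: "\<And>s t. s \<in> cball 0 R \<Longrightarrow> t \<in> cball 0 R \<Longrightarrow> (\<lambda>s. h s t) field_differentiable at s"
    and ht: "\<And>s t. s \<in> cball 0 R \<Longrightarrow> t \<in> cball 0 R \<Longrightarrow> h s field_differentiable at t"
  obtains D where "((\<lambda>s. deriv (h s) 0) has_field_derivative D) (at 0)"
    and "((\<lambda>t. deriv (\<lambda>s. h s t) 0) has_field_derivative D) (at 0)"
proof -
  have "compact ((\<lambda>(s, t). h s t) ` (cball 0 R \<times> cball 0 R))"
    by (intro compact_continuous_image cont compact_Times compact_cball)
  then obtain B where "cmod x \<le> B" if "x \<in> (\<lambda>(s, t). h s t) ` (cball 0 R \<times> cball 0 R)" for x
    by (metis compact_imp_bounded bounded_iff)
  from this[of "h s t" for s t] have B: "cmod (h s t) \<le> B" if "s \<in> cball 0 R" "t \<in> cball 0 R" for s t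
    using that by (metis (no_types, lifting) SigmaI case_prod_conv image_eqI)
  \<comment> \<open>\<open>C\<close> bounds the second derivative of every \<open>h s\<close> on the
    disc of radius \<open>R / 2\<close>: it is Cauchy's inequality on discs of radius
    \<open>R / 2\<close> around its points, which stay inside \<open>cball 0 R\<close>, where
    \<open>B\<close> bounds \<open>h\<close>. It does not depend on \<open>s\<close>, which makes
    the convergence below uniform.\<close>
  define C where "C = 2 * B / (R / 2)\<^sup>2"
  have "0 \<le> B" using order_trans[OF norm_ge_zero B[of 0 0]] \<open>0 < R\<close> by simp
  then have "0 \<le> C" by (simp add: C_def)
  have hol: "h s holomorphic_on ball 0 R" if "s \<in> cball 0 R" for s
    unfolding holomorphic_on_def using that ht
    by (meson ball_subset_cball field_differentiable_at_within subsetD)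
  have taylor: "cmod (h s t - h s 0 - deriv (h s) 0 * t) \<le> C * (cmod t)\<^sup>2"
    if s: "s \<in> cball 0 R" and t: "t \<in> cball 0 (R / 2)" for s t
  proof -
    have d: "((deriv ^^ i) (h s) has_field_derivative (deriv ^^ Suc i) (h s) x) (at x within cball 0 (R / 2))"
      if "x \<in> cball 0 (R / 2)" for i x
    proof -
      have "x \<in> ball 0 R" using that \<open>0 < R\<close> by auto
      then show ?thesis
        using holomorphic_derivI[OF holomorphic_higher_deriv[OF hol[OF s] open_ball, of i] open_ball]
        by (simp add: has_field_derivative_at_within)
    qed
    have b: "cmod ((deriv ^^ Suc 1) (h s) x) \<le> C" if x: "x \<in> cball 0 (R / 2)" for x
    proof -
      have sub: "y \<in> cball 0 R" if "y \<in> cball x (R / 2)" for y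
        using x that norm_triangle_ineq4[of x "x - y"] by (simp add: dist_norm)
      have "cmod ((deriv ^^ 2) (h s) x) \<le> fact 2 * B / (R / 2) ^ 2"
      proof (rule Cauchy_inequality)
        show "h s holomorphic_on ball x (R / 2)"
          unfolding holomorphic_on_def using sub s ht
          by (meson ball_subset_cball field_differentiable_at_within subsetD)
        show "continuous_on (cball x (R / 2)) (h s)"
          using sub s ht by (meson continuous_at_imp_continuous_on field_differentiable_imp_continuous_at)
        show "cmod (h s y) \<le> B" if "cmod (x - y) = R / 2" for y
          using sub[of y] B[OF s, of y] that by (simp add: dist_norm)
      qed (use \<open>0 < R\<close> in auto)
      then show ?thesis by (simp add: C_def numeral_2_eq_2)
    qed
    have "cmod ((deriv ^^ 0) (h s) t - (\<Sum>i\<le>1. (deriv ^^ i) (h s) 0 * (t - 0) ^ i / fact i))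
        \<le> C * cmod (t - 0) ^ Suc 1 / fact 1"
      by (rule complex_Taylor[OF convex_cball d b _ t]) (use \<open>0 < R\<close> in auto)
    then show ?thesis by (simp add: algebra_simps power2_eq_square)
  qed
  define f where "f t s = (h s t - h s 0) / t" for t s
  define f' where "f' t s = (deriv (\<lambda>s. h s t) s - deriv (\<lambda>s. h s 0) s) / t" for t s
  have small: "\<forall>\<^sub>F t in at 0. t \<in> cball 0 (R / 2) - {0::complex}"
    unfolding eventually_at using \<open>0 < R\<close> by (intro exI[of _ "R / 2"]) (auto simp: dist_norm)
  have 1: "\<forall>\<^sub>F t in at 0. continuous_on (cball 0 R) (f t) \<and>
      (\<forall>s\<in>ball 0 R. (f t has_field_derivative f' t s) (at s))"
    using small
  proof eventually_elim
    case (elim t)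
    then have "t \<in> cball 0 R" "0 \<in> cball 0 R" using \<open>0 < R\<close> by auto
    have "(f t has_field_derivative f' t s) (at s)" if "s \<in> cball 0 R" for s
      unfolding f_def f'_def
      by (rule DERIV_cdivide[OF DERIV_diff[OF hs[OF that \<open>t \<in> cball 0 R\<close>, THEN field_differentiable_derivI]
            hs[OF that \<open>0 \<in> cball 0 R\<close>, THEN field_differentiable_derivI]]])
    then show ?case by (meson DERIV_continuous_on ball_subset_cball has_field_derivative_at_within subsetD)
  qed
  have 2: "uniform_limit (cball 0 R) f (\<lambda>s. deriv (h s) 0) (at 0)"
  proof (rule uniform_limitI)
    fix e :: real assume "0 < e"
    \<comment> \<open>The denominator is \<open>C + 1\<close> because \<open>C\<close> may be
      0.\<close>
    have "\<forall>\<^sub>F t in at 0. cmod t < e / (C + 1)"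
      unfolding eventually_at using \<open>0 < e\<close> \<open>0 \<le> C\<close>
      by (intro exI[of _ "e / (C + 1)"]) (auto simp: dist_norm)
    with small show "\<forall>\<^sub>F t in at 0. \<forall>s\<in>cball 0 R. dist (f t s) (deriv (h s) 0) < e"
    proof eventually_elim
      case (elim t)
      show ?case
      proof
        fix s :: complex assume s: "s \<in> cball 0 R"
        have "t \<noteq> 0" using elim by auto
        have "dist (f t s) (deriv (h s) 0) = cmod (h s t - h s 0 - deriv (h s) 0 * t) / cmod t"
          using \<open>t \<noteq> 0\<close> by (simp add: f_def dist_norm field_simps flip: norm_divide)
        also have "\<dots> \<le> C * cmod t"
          using taylor[OF s, of t] elim \<open>t \<noteq> 0\<close> by (simp add: divide_simps power2_eq_square mult_ac)
        also have "\<dots> \<le> (C + 1) * cmod t" by (simp add: algebra_simps)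
        also have "\<dots> < e" using elim \<open>0 \<le> C\<close> by (simp add: field_simps)
        finally show "dist (f t s) (deriv (h s) 0) < e" .
      qed
    qed
  qed
  \<comment> \<open>At \<open>w = 0\<close> the quotient \<open>f' t 0\<close> is the difference
    quotient of \<open>\<lambda>t. deriv (\<lambda>s. h s t) 0\<close>, so \<open>g' 0\<close> is
    the common value of both mixed derivatives.\<close>
  obtain g' where "\<And>w. w \<in> ball 0 R \<Longrightarrow>
      ((\<lambda>s. deriv (h s) 0) has_field_derivative g' w) (at w) \<and> ((\<lambda>t. f' t w) \<longlongrightarrow> g' w) (at 0)"
    using has_complex_derivative_uniform_limit[OF 1 2 _ \<open>0 < R\<close>] by auto
  from this[of 0] \<open>0 < R\<close> show thesis
    by (intro that[of "g' 0"]) (auto simp: has_field_derivative_iff f'_def)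
qed

section \<open>Complex partial derivatives along coordinate lines\<close>

lemma bounded_linear_axis: "bounded_linear (axis k :: 'b::euclidean_space \<Rightarrow> 'b^'m)"
  by (intro linear_conv_bounded_linear[THEN iffD1] linearI) (auto simp: axis_def vec_eq_iff)

lemma axis_zero [simp]: "axis k 0 = 0"
  by (simp add: axis_def vec_eq_iff)

lemma norm_axis: "norm (axis k x :: 'b::euclidean_space^'m) = norm x"
  by (simp add: norm_eq_sqrt_inner inner_axis_axis)

lemma has_derivative_line:
  fixes f :: "complex^'m \<Rightarrow> complex"
  assumes "(f has_derivative (\<lambda>v. \<Sum>i\<in>UNIV. a i * v $ i)) (at (z + axis k t))"
  shows "((\<lambda>t. f (z + axis k t)) has_field_derivative a k) (at t)"
proof -
  have "((\<lambda>t. z + axis k t) has_derivative axis k) (at t)"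
    using has_derivative_add[OF has_derivative_const bounded_linear_imp_has_derivative[OF bounded_linear_axis]]
    by simp
  from has_derivative_compose[OF this assms]
  have "((\<lambda>t. f (z + axis k t)) has_derivative (\<lambda>v. \<Sum>i\<in>UNIV. a i * axis k v $ i)) (at t)" .
  also have "(\<lambda>v. \<Sum>i\<in>UNIV. a i * axis k v $ i) = (*) (a k)"
    by (auto simp: axis_def if_distrib[of "\<lambda>x. _ * x"] cong: if_cong)
  finally show ?thesis by (simp add: has_field_derivative_def)
qed

lemma cpartial_eq:
  assumes "(f has_derivative (\<lambda>v. \<Sum>i\<in>UNIV. a i * v $ i)) (at z)"
  shows "cpartial k f z = a k"
  using has_derivative_line[of f a z k 0] assms by (simp add: cpartial_def DERIV_imp_deriv)

lemma holo_fun_has_derivative: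
  assumes "holo_fun f S" "z \<in> S"
  shows "(f has_derivative (\<lambda>v. \<Sum>i\<in>UNIV. cpartial i f z * v $ i)) (at z)"
proof -
  obtain a :: "complex^'a" where a: "(f has_derivative (\<lambda>v. \<Sum>i\<in>UNIV. a $ i * v $ i)) (at z)"
    using assms unfolding holo_fun_def by auto
  with cpartial_eq[OF a] show ?thesis by simp
qed

lemma holo_fun_line:
  assumes "holo_fun f S" "z + axis k t \<in> S"
  shows "((\<lambda>t. f (z + axis k t)) has_field_derivative cpartial k f (z + axis k t)) (at t)"
  using has_derivative_line[OF holo_fun_has_derivative[OF assms]] .

lemma holo_fun_cpartial:
  assumes "holo_fun f S" "z \<in> S"
  shows "((\<lambda>t. f (z + axis k t)) has_field_derivative cpartial k f z) (at 0)"
  using holo_fun_line[OF assms(1), of z k 0] assms(2) by simp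

text \<open>\<open>holo_fun\<close> provides first derivatives only. Restricting \<open>f\<close> to
  the translates of \<open>z\<close> along the axes \<open>i\<close> and \<open>j\<close> gives a
  function of two complex variables to which \<open>separately_holomorphic_derivs\<close>
  applies.\<close>

lemma
  assumes f: "holo_fun f S" and z: "z \<in> S"
  shows holo_fun_cpartial2:
      "((\<lambda>t. cpartial j f (z + axis i t)) has_field_derivative cpartial i (cpartial j f) z) (at 0)"
    and cpartial_commute: "cpartial i (cpartial j f) z = cpartial j (cpartial i f) z"
proof -
  have "open S" using f by (simp add: holo_fun_def)
  then obtain e where "0 < e" and e: "ball z e \<subseteq> S" using z by (meson open_contains_ball)
  \<comment> \<open>With a third of \<open>e\<close>, two displacements of norm at most
    \<open>R\<close> together stay strictly inside the ball of radius \<open>e\<close>.\<close>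
  define R where "R = e / 3"
  have "0 < R" using \<open>0 < e\<close> by (simp add: R_def)
  define h where "h s t = f (z + axis i s + axis j t)" for s t
  have inS: "z + axis i s + axis j t \<in> S" if "s \<in> cball 0 R" "t \<in> cball 0 R" for s t
  proof -
    have "norm (axis i s + axis j t) \<le> R + R"
      by (intro norm_triangle_mono) (use that in \<open>auto simp: norm_axis\<close>)
    then have "dist (z + axis i s + axis j t) z < e"
      using \<open>0 < e\<close> by (simp add: dist_norm R_def add.assoc)
    then have "z + axis i s + axis j t \<in> ball z e"
      by (simp add: dist_commute)
    with e show ?thesis by blast
  qed
  have swap: "z + axis i s + axis j t = z + axis j t + axis i s" for s t by simp
  have ht: "(h s has_field_derivative cpartial j f (z + axis i s + axis j t)) (at t)"
    if "s \<in> cball 0 R" "t \<in> cball 0 R" for s t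
    unfolding h_def using holo_fun_line[OF f inS[OF that]] .
  have hs: "((\<lambda>s. h s t) has_field_derivative cpartial i f (z + axis j t + axis i s)) (at s)"
    if "s \<in> cball 0 R" "t \<in> cball 0 R" for s t
    unfolding h_def swap using holo_fun_line[OF f inS[OF that, unfolded swap]] .
  have cont: "continuous_on (cball 0 R \<times> cball 0 R) (\<lambda>(s, t). h s t)"
  proof -
    have "continuous_on S f"
      using holo_fun_has_derivative[OF f]
      by (auto intro!: continuous_at_imp_continuous_on has_derivative_continuous)
    then have "continuous_on (cball 0 R \<times> cball 0 R) (\<lambda>p. f (z + axis i (fst p) + axis j (snd p)))"
      by (rule continuous_on_compose2)
        (auto intro!: continuous_intros bounded_linear.continuous_on[OF bounded_linear_axis] inS)
    then show ?thesis by (simp add: h_def case_prod_unfold)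
  qed
  obtain D where D: "((\<lambda>s. deriv (h s) 0) has_field_derivative D) (at 0)"
    "((\<lambda>t. deriv (\<lambda>s. h s t) 0) has_field_derivative D) (at 0)"
    by (rule separately_holomorphic_derivs[OF \<open>0 < R\<close> cont])
      (use ht hs in \<open>unfold field_differentiable_def, blast+\<close>)
  \<comment> \<open>Inner derivatives agree with \<open>cpartial\<close> only for small parameters,
    so the outer derivatives at 0 are transferred along eventual equality.\<close>
  have near: "\<forall>\<^sub>F s in nhds 0. s \<in> cball 0 R"
    using eventually_nhds_in_open[OF open_ball, of 0 0 R] \<open>0 < R\<close> by (auto elim: eventually_mono)
  have "deriv (h s) 0 = cpartial j f (z + axis i s)" if "s \<in> cball 0 R" for s
    using ht[OF that, of 0] \<open>0 < R\<close> by (simp add: DERIV_imp_deriv)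
  then have ev1: "\<forall>\<^sub>F s in nhds 0. deriv (h s) 0 = cpartial j f (z + axis i s)"
    by (rule eventually_mono[OF near])
  have 1: "((\<lambda>s. cpartial j f (z + axis i s)) has_field_derivative D) (at 0)"
    by (rule DERIV_cong_ev[OF refl ev1 refl, THEN iffD1, OF D(1)])
  have "deriv (\<lambda>s. h s t) 0 = cpartial i f (z + axis j t)" if "t \<in> cball 0 R" for t
    using hs[OF _ that, of 0] \<open>0 < R\<close> by (simp add: DERIV_imp_deriv)
  then have ev2: "\<forall>\<^sub>F t in nhds 0. deriv (\<lambda>s. h s t) 0 = cpartial i f (z + axis j t)"
    by (rule eventually_mono[OF near])
  have 2: "((\<lambda>t. cpartial i f (z + axis j t)) has_field_derivative D) (at 0)"
    by (rule DERIV_cong_ev[OF refl ev2 refl, THEN iffD1, OF D(2)])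
  have D_eq: "cpartial i (cpartial j f) z = D" "cpartial j (cpartial i f) z = D"
    using 1 2 by (auto simp: cpartial_def intro!: DERIV_imp_deriv)
  show "((\<lambda>t. cpartial j f (z + axis i t)) has_field_derivative cpartial i (cpartial j f) z) (at 0)"
    using 1 D_eq by simp
  show "cpartial i (cpartial j f) z = cpartial j (cpartial i f) z"
    using D_eq by simp
qed

section \<open>Hermitian linear algebra\<close>

lemma matrix_inv_mult:
  fixes A :: "complex^'n^'n"
  assumes "invertible A"
  shows "A ** matrix_inv A = mat 1" "matrix_inv A ** A = mat 1"
  using assms unfolding invertible_def matrix_inv_def by (metis (mono_tags, lifting) someI_ex)+

lemma matrix_inv_unique:
  fixes A B :: "complex^'n^'n"
  assumes "invertible A" "A ** B = mat 1"
  shows "matrix_inv A = B"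
  using matrix_mul_assoc[of "matrix_inv A" A B] matrix_inv_mult[OF assms(1)] assms(2) by simp

lemma matrix_mul_minus:
  fixes A B :: "complex^'n^'n"
  shows "A ** (- B) = - (A ** B)" "(- A) ** B = - (A ** B)"
  by (simp_all add: matrix_matrix_mult_def vec_eq_iff sum_negf)

lemma transpose_matrix_inv:
  fixes A :: "complex^'n^'n"
  assumes "invertible A" "transpose A = A"
  shows "transpose (matrix_inv A) = matrix_inv A"
proof (rule matrix_inv_unique[OF assms(1), symmetric])
  have "transpose (matrix_inv A ** A) = mat 1"
    by (simp add: matrix_inv_mult assms(1) transpose_mat)
  then show "A ** transpose (matrix_inv A) = mat 1"
    by (simp add: matrix_transpose_mul assms(2))
qed

lemma transpose_eq_minus_iff:
  fixes A :: "complex^'n^'n"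
  shows "transpose A = - A \<longleftrightarrow> (\<forall>i j. A $ i $ j = - A $ j $ i)"
  by (auto simp: transpose_def vec_eq_iff)

lemma matrix_mult_axis: "((A :: complex^'n^'m) *v axis i 1) $ a = A $ a $ i"
  by (simp add: matrix_vector_mult_def axis_def if_distrib cong: if_cong)

lemma matrix_vector_mult_minus_left: "(- A :: complex^'n^'m) *v x = - (A *v x)"
  by (simp add: matrix_vector_mult_def vec_eq_iff sum_negf)

lemma bil_axis: "bil G (axis i 1) (axis j 1) = G $ i $ j"
proof -
  have "bil G (axis i 1) (axis j 1) = (\<Sum>i'\<in>UNIV. \<Sum>j'\<in>UNIV. if i' = i then if j' = j then G $ i' $ j' else 0 else 0)"
    unfolding bil_def by (intro sum.cong) (auto simp: axis_def)
  also have "\<dots> = G $ i $ j"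
    by (subst sum.swap) simp
  finally show ?thesis .
qed

lemma bil_columns: "bil G (A *v axis i 1) (A *v axis j 1) = (transpose A ** G ** A) $ i $ j"
proof -
  have "bil G (A *v axis i 1) (A *v axis j 1) = (\<Sum>a\<in>UNIV. \<Sum>b\<in>UNIV. A $ a $ i * G $ a $ b * A $ b $ j)"
    by (simp add: bil_def matrix_mult_axis mult_ac)
  also have "\<dots> = (\<Sum>b\<in>UNIV. \<Sum>a\<in>UNIV. A $ a $ i * G $ a $ b * A $ b $ j)"
    by (rule sum.swap)
  finally show ?thesis
    by (simp add: matrix_matrix_mult_def transpose_def sum_distrib_right)
qed

text \<open>Orthogonality tested on coordinate vectors reads
  \<open>transpose J ** G ** J = G\<close>; multiplying by \<open>J\<close> on the right and using
  \<open>J2\<close> moves \<open>J\<close> across \<open>G\<close> with a sign.\<close>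

lemma hermitian_skew:
  fixes G J :: "complex^'n^'n"
  assumes J2: "J ** J = - mat 1" and orth: "\<And>v w. bil G (J *v v) (J *v w) = bil G v w"
  shows "transpose J ** G = - (G ** J)"
proof -
  have "transpose J ** G ** J = G"
    using orth[of "axis i 1" "axis j 1" for i j] by (simp add: bil_columns bil_axis vec_eq_iff)
  then have "G ** J = transpose J ** G ** (J ** J)"
    by (simp add: matrix_mul_assoc)
  also have "\<dots> = - (transpose J ** G)"
    by (simp add: J2 matrix_mul_minus)
  finally show ?thesis by simp
qed

text \<open>Multiply the skewness relation by \<open>matrix_inv G\<close> on both sides:
  \<open>J\<close> is skew for the metric on covectors as well.\<close>

lemma inverse_metric_skew:
  fixes G J :: "complex^'n^'n"
  assumes "invertible G" "transpose J ** G = - (G ** J)"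
  shows "matrix_inv G ** transpose J = - (J ** matrix_inv G)"
proof -
  have "matrix_inv G ** transpose J = matrix_inv G ** (transpose J ** G) ** matrix_inv G"
    using matrix_inv_mult[OF assms(1)] by (simp flip: matrix_mul_assoc)
  also have "\<dots> = - (matrix_inv G ** G ** J ** matrix_inv G)"
    by (simp add: assms(2) matrix_mul_minus matrix_mul_assoc)
  finally show ?thesis using matrix_inv_mult[OF assms(1)] by simp
qed

text \<open>The trace is the contraction of \<open>B\<close> with
  \<open>matrix_inv G ** transpose J\<close>, that is, of a symmetric with a skew matrix.\<close>

lemma trace_form_symmetric_J:
  fixes G J :: "complex^'n^'n"
  assumes "invertible G" "transpose G = G" "transpose J ** G = - (G ** J)"
    and sym: "\<And>i j. B i j = B j i"
  shows "trace_form G (\<lambda>i j. \<Sum>k\<in>UNIV. B i k * J $ k $ j) = 0"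
proof -
  define A where "A = matrix_inv G ** transpose J"
  have "transpose A = J ** matrix_inv G"
    by (simp add: A_def matrix_transpose_mul transpose_matrix_inv assms)
  then have "transpose A = - A"
    using inverse_metric_skew[OF assms(1,3)] by (simp add: A_def)
  then have skew: "A $ i $ j = - A $ j $ i" for i j
    unfolding transpose_eq_minus_iff by blast
  have "trace_form G (\<lambda>i j. \<Sum>k\<in>UNIV. B i k * J $ k $ j)
      = (\<Sum>i\<in>UNIV. \<Sum>k\<in>UNIV. A $ i $ k * B i k)" (is "_ = ?T")
    unfolding trace_form_def
  proof (rule sum.cong[OF refl])
    fix i
    have "(\<Sum>j\<in>UNIV. matrix_inv G $ i $ j * (\<Sum>k\<in>UNIV. B i k * J $ k $ j))
        = (\<Sum>k\<in>UNIV. \<Sum>j\<in>UNIV. matrix_inv G $ i $ j * (B i k * J $ k $ j))"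
      by (subst sum.swap) (simp only: sum_distrib_left)
    also have "\<dots> = (\<Sum>k\<in>UNIV. A $ i $ k * B i k)"
      by (simp add: A_def matrix_matrix_mult_def transpose_def sum_distrib_left sum_distrib_right mult_ac)
    finally show "(\<Sum>j\<in>UNIV. matrix_inv G $ i $ j * (\<Sum>k\<in>UNIV. B i k * J $ k $ j))
        = (\<Sum>k\<in>UNIV. A $ i $ k * B i k)" .
  qed
  moreover have "?T = - ?T"
    by (subst (2) sum.swap, subst skew) (simp add: sum_negf sym)
  ultimately show ?thesis by simp
qed

text \<open>Pair \<open>x\<close> with \<open>y \<circ> J\<close> in the inverse metric. The
  eigenvalue equation for \<open>y\<close> gives \<open>- r * T\<close>; shifting \<open>J\<close>
  onto \<open>x\<close> by skewness and using the equation for \<open>x\<close> gives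
  \<open>r * T\<close>.\<close>

lemma trace_form_eigen_covectors:
  fixes G J :: "complex^'n^'n"
  assumes "invertible G" "transpose J ** G = - (G ** J)" "r \<noteq> 0"
    and x: "\<And>j. (\<Sum>k\<in>UNIV. x k * J $ k $ j) = - r * x j"
    and y: "\<And>j. (\<Sum>k\<in>UNIV. y k * J $ k $ j) = - r * y j"
  shows "trace_form G (\<lambda>i j. x i * y j) = 0"
proof -
  let ?G = "matrix_inv G"
  define T where "T = trace_form G (\<lambda>i j. x i * y j)"
  have swap: "(\<Sum>i\<in>UNIV. \<Sum>j\<in>UNIV. ?G $ i $ j * (x i * (\<Sum>k\<in>UNIV. y k * J $ k $ j)))
      = (\<Sum>i\<in>UNIV. \<Sum>k\<in>UNIV. (?G ** transpose J) $ i $ k * (x i * y k))"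
  proof (rule sum.cong[OF refl])
    fix i
    have "(\<Sum>j\<in>UNIV. ?G $ i $ j * (x i * (\<Sum>k\<in>UNIV. y k * J $ k $ j)))
        = (\<Sum>k\<in>UNIV. \<Sum>j\<in>UNIV. ?G $ i $ j * (x i * (y k * J $ k $ j)))"
      by (subst sum.swap) (simp only: sum_distrib_left)
    also have "\<dots> = (\<Sum>k\<in>UNIV. (?G ** transpose J) $ i $ k * (x i * y k))"
      by (simp add: matrix_matrix_mult_def transpose_def sum_distrib_left sum_distrib_right mult_ac)
    finally show "(\<Sum>j\<in>UNIV. ?G $ i $ j * (x i * (\<Sum>k\<in>UNIV. y k * J $ k $ j)))
        = (\<Sum>k\<in>UNIV. (?G ** transpose J) $ i $ k * (x i * y k))" .
  qed
  have swap': "(\<Sum>k\<in>UNIV. \<Sum>i\<in>UNIV. (J ** ?G) $ i $ k * (x i * y k))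
      = (\<Sum>k\<in>UNIV. \<Sum>j\<in>UNIV. ?G $ j $ k * ((\<Sum>i\<in>UNIV. x i * J $ i $ j) * y k))"
  proof (rule sum.cong[OF refl])
    fix k
    have "(\<Sum>j\<in>UNIV. ?G $ j $ k * ((\<Sum>i\<in>UNIV. x i * J $ i $ j) * y k))
        = (\<Sum>i\<in>UNIV. \<Sum>j\<in>UNIV. ?G $ j $ k * (x i * J $ i $ j * y k))"
      by (subst sum.swap) (simp only: sum_distrib_left sum_distrib_right)
    also have "\<dots> = (\<Sum>i\<in>UNIV. (J ** ?G) $ i $ k * (x i * y k))"
      by (simp add: matrix_matrix_mult_def sum_distrib_left sum_distrib_right mult_ac)
    finally show "(\<Sum>i\<in>UNIV. (J ** ?G) $ i $ k * (x i * y k))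
        = (\<Sum>j\<in>UNIV. ?G $ j $ k * ((\<Sum>i\<in>UNIV. x i * J $ i $ j) * y k))" ..
  qed
  have "- r * T = (\<Sum>i\<in>UNIV. \<Sum>k\<in>UNIV. (?G ** transpose J) $ i $ k * (x i * y k))"
    by (simp only: flip: swap) (simp add: y T_def trace_form_def sum_distrib_left sum_negf mult_ac)
  also have "\<dots> = - (\<Sum>k\<in>UNIV. \<Sum>i\<in>UNIV. (J ** ?G) $ i $ k * (x i * y k))"
    by (subst sum.swap) (simp add: inverse_metric_skew[OF assms(1,2)] sum_negf)
  also have "\<dots> = r * T"
    unfolding swap' x T_def trace_form_def
    by (subst sum.swap) (simp add: sum_distrib_left sum_negf mult_ac)
  finally show ?thesis using \<open>r \<noteq> 0\<close> by (simp add: T_def)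
qed

text \<open>Since \<open>r * r = -1\<close>, each vector \<open>J e + r e\<close> is an eigenvector
  for \<open>r\<close>. A covector annihilating that eigenspace therefore satisfies
  \<open>x (J e) = - r * x e\<close>; take for \<open>e\<close> the coordinate vectors.\<close>

lemma covector_eigen:
  fixes J :: "complex^'n^'n"
  assumes J2: "J ** J = - mat 1" and r: "r * r = -1"
    and ann: "\<And>v. J *v v = r *s v \<Longrightarrow> (\<Sum>k\<in>UNIV. x k * v $ k) = 0"
  shows "(\<Sum>k\<in>UNIV. x k * J $ k $ j) = - r * x j"
proof -
  define v where "v = J *v axis j 1 + r *s axis j 1"
  have "J *v v = (J ** J) *v axis j 1 + r *s (J *v axis j 1)"
    by (simp add: v_def matrix_vector_right_distrib matrix_vector_mul_assoc vector_scalar_commute)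
  also have "(J ** J) *v axis j 1 = (r * r) *s axis j 1"
    by (simp add: J2 r matrix_vector_mult_minus_left vec_eq_iff)
  also have "\<dots> + r *s (J *v axis j 1) = r *s v"
    by (simp add: v_def vector_add_ldistrib vector_smult_assoc)
  finally have "(\<Sum>k\<in>UNIV. x k * v $ k) = 0" by (rule ann)
  moreover have "x k * v $ k = x k * J $ k $ j + (if k = j then x k * r else 0)" for k
    by (simp add: v_def matrix_mult_axis distrib_left) (simp add: axis_def)
  ultimately show ?thesis
    by (simp add: sum.distrib eq_neg_iff_add_eq_0 mult.commute)
qed

section \<open>The trace of the covariant derivative of an almost complex structure\<close>

lemma matrix_add_rdistrib:
  fixes A B C :: "complex^'n^'n"
  shows "(B + C) ** A = B ** A + C ** A"
  by (simp add: matrix_matrix_mult_def vec_eq_iff sum.distrib algebra_simps)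

lemma matrix_mul_diff:
  fixes A B C :: "complex^'n^'n"
  shows "A ** (B - C) = A ** B - A ** C" "(B - C) ** A = B ** A - C ** A"
  by (simp_all add: matrix_matrix_mult_def vec_eq_iff sum_subtractf algebra_simps)

lemma transpose_linear:
  fixes A B :: "complex^'n^'n"
  shows "transpose (A + B) = transpose A + transpose B"
    "transpose (A - B) = transpose A - transpose B"
    "transpose (- A) = - transpose A"
  by (simp_all add: transpose_def vec_eq_iff)

text \<open>\<open>G ** J\<close> is invertible and skew, and a skew matrix of odd size has
  determinant zero. This is what leaves only dimension 2 or at least 4 later.\<close>

lemma hermitian_even_dim:
  fixes G J :: "complex^'n^'n"
  assumes G: "invertible G" "transpose G = G" and J2: "J ** J = - mat 1"
    and skew: "transpose J ** G = - (G ** J)"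
  shows "even CARD('n)"
proof (rule ccontr)
  assume odd: "odd CARD('n)"
  define P where "P = G ** J"
  have "invertible J"
    unfolding invertible_def by (intro exI[of _ "- J"]) (simp add: matrix_mul_minus J2)
  then have "det P \<noteq> 0"
    using G(1) by (simp add: P_def det_mul invertible_det_nz)
  have "transpose P = - P"
    by (simp add: P_def matrix_transpose_mul G(2) skew)
  moreover have "- P = (\<chi> i. (- 1) *s (P $ i))"
    by (simp add: vec_eq_iff)
  ultimately have "det (transpose P) = det (\<chi> i. (- 1) *s (P $ i))"
    by (rule arg_cong[OF trans])
  then have "det P = - det P"
    unfolding det_rows_mul det_transpose using odd by simp
  with \<open>det P \<noteq> 0\<close> show False by simp
qed

section \<open>Linearity of the trace and differentiation of pointwise identities\<close>

lemma trace_form_add: "trace_form G (\<lambda>i j. A i j + B i j) = trace_form G A + trace_form G B"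
  by (simp add: trace_form_def distrib_left sum.distrib)

lemma trace_form_scale: "trace_form G (\<lambda>i j. c * A i j) = c * trace_form G A"
  by (simp add: trace_form_def sum_distrib_left mult_ac)

lemma trace_form_sum: "finite K \<Longrightarrow> trace_form G (\<lambda>i j. \<Sum>k\<in>K. B k i j) = (\<Sum>k\<in>K. trace_form G (B k))"
  by (induction K rule: finite_induct) (simp_all add: trace_form_add, simp add: trace_form_def)

lemma eventually_line_in_open:
  fixes z :: "complex^'m"
  assumes "open S" "z \<in> S"
  shows "\<forall>\<^sub>F t in nhds 0. z + axis i t \<in> S"
proof -
  have "((\<lambda>t. z + axis i t) \<longlongrightarrow> z + axis i 0) (nhds 0)"
    by (intro tendsto_intros bounded_linear.tendsto[OF bounded_linear_axis] filterlim_ident)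
  then show ?thesis using assms by (simp add: topological_tendstoD)
qed

text \<open>A coordinate line through \<open>z\<close> stays in the open set \<open>S\<close> for
  small parameters. This allows identities known only near \<open>z\<close>, such as
  \<open>J w ** J w = - mat 1\<close>, to be differentiated there.\<close>

lemma DERIV_line_unique:
  fixes z :: "complex^'m" and f g :: "complex^'m \<Rightarrow> complex"
  assumes "open S" "z \<in> S" and eq: "\<And>w. w \<in> S \<Longrightarrow> f w = g w"
    and "((\<lambda>t. f (z + axis i t)) has_field_derivative a) (at 0)"
    and "((\<lambda>t. g (z + axis i t)) has_field_derivative b) (at 0)"
  shows "a = b"
proof -
  have "\<forall>\<^sub>F t in nhds 0. f (z + axis i t) = g (z + axis i t)"
    by (rule eventually_mono[OF eventually_line_in_open[OF assms(1,2)] eq])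
  from DERIV_cong_ev[OF refl this refl, THEN iffD1, OF assms(4)]
  show ?thesis using assms(5) by (rule DERIV_unique)
qed

text \<open>The identity \<open>du (trace DJ) = - r trace (D du)\<close> at one point of a chart.
  Only \<open>u\<close> and \<open>J\<close> are differentiated, so they are given near
  \<open>z\<close>, while \<open>\<Gamma>\<close> and \<open>G\<close> are values at
  \<open>z\<close>. \<open>S\<close> is the domain of \<open>u\<close>, and \<open>T\<close> the
  chart domain on which \<open>J\<close> is holomorphic.\<close>

lemma trace_hessian_eigen_covector:
  fixes u :: "complex^'m \<Rightarrow> complex" and J :: "complex^'m \<Rightarrow> complex^'m^'m"
  assumes u: "holo_fun u S" and z: "z \<in> S"
    and J: "\<And>k j. holo_fun (\<lambda>w. J w $ k $ j) T" and T: "S \<subseteq> T"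
    and J2: "\<And>w. w \<in> S \<Longrightarrow> J w ** J w = - mat 1" and r: "r * r = -1"
    and G: "invertible G" "transpose G = G" "transpose (J z) ** G = - (G ** J z)"
    and ann: "\<And>w v. w \<in> S \<Longrightarrow> J w *v v = r *s v \<Longrightarrow> (\<Sum>k\<in>UNIV. cpartial k u w * v $ k) = 0"
    and torsion: "\<And>k i j. \<Gamma> k i j = \<Gamma> k j i"
  shows "(\<Sum>k\<in>UNIV. cpartial k u z * trace_form G (\<lambda>i j. cov_deriv_endo \<Gamma> J z i k j))
    = - r * trace_form G (\<lambda>i j. cpartial i (cpartial j u) z - (\<Sum>k\<in>UNIV. \<Gamma> k i j * cpartial k u z))"
proof -
  have "open S" using u by (simp add: holo_fun_def)
  have eigen: "(\<Sum>k\<in>UNIV. cpartial k u w * J w $ k $ j) = - r * cpartial j u w" if "w \<in> S" for w j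
    using covector_eigen[OF J2[OF that] r ann[OF that]] .
  define dJ where "dJ i k j = cpartial i (\<lambda>w. J w $ k $ j) z" for i k j
  define du where "du k = cpartial k u z" for k
  define ddu where "ddu i j = cpartial i (cpartial j u) z" for i j
  define H where "H i j = ddu i j - (\<Sum>k\<in>UNIV. \<Gamma> k i j * du k)" for i j
  have "z \<in> T" using z T by blast
  \<comment> \<open>The product rule applied to \<open>eigen\<close> in direction
    \<open>i\<close>.\<close>
  have diff: "(\<Sum>k\<in>UNIV. ddu i k * J z $ k $ j) + (\<Sum>k\<in>UNIV. du k * dJ i k j) = - r * ddu i j" for i j
  proof (rule DERIV_line_unique[OF \<open>open S\<close> z eigen])
    have "((\<lambda>t. \<Sum>k\<in>UNIV. cpartial k u (z + axis i t) * J (z + axis i t) $ k $ j) has_field_derivative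
        (\<Sum>k\<in>UNIV. cpartial i (cpartial k u) z * J (z + axis i 0) $ k $ j + dJ i k j * cpartial k u (z + axis i 0))) (at 0)"
      unfolding dJ_def
      by (intro DERIV_sum DERIV_mult holo_fun_cpartial2[OF u z] holo_fun_cpartial[OF J \<open>z \<in> T\<close>])
    then show "((\<lambda>t. \<Sum>k\<in>UNIV. cpartial k u (z + axis i t) * J (z + axis i t) $ k $ j) has_field_derivative
        ((\<Sum>k\<in>UNIV. ddu i k * J z $ k $ j) + (\<Sum>k\<in>UNIV. du k * dJ i k j))) (at 0)"
      by (simp add: ddu_def du_def sum.distrib mult.commute)
    show "((\<lambda>t. - r * cpartial j u (z + axis i t)) has_field_derivative - r * ddu i j) (at 0)"
      unfolding ddu_def by (intro DERIV_cmult holo_fun_cpartial2[OF u z])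
  qed
  \<comment> \<open>The covariant form of \<open>diff\<close>. The Christoffel terms containing
    \<open>\<Gamma> k i l * J z $ l $ j\<close> cancel between \<open>H\<close> and
    \<open>DJ\<close>; in the other term of \<open>DJ\<close>, \<open>eigen\<close> replaces
    \<open>du \<circ> J\<close> by \<open>- r du\<close>, which supplies the Christoffel part of
    \<open>- r * H i j\<close>.\<close>
  have key: "(\<Sum>k\<in>UNIV. H i k * J z $ k $ j) + (\<Sum>k\<in>UNIV. du k * cov_deriv_endo \<Gamma> J z i k j) = - r * H i j" for i j
  proof -
    have 1: "(\<Sum>k\<in>UNIV. H i k * J z $ k $ j) = (\<Sum>k\<in>UNIV. ddu i k * J z $ k $ j)
        - (\<Sum>l\<in>UNIV. \<Sum>k\<in>UNIV. du k * (\<Gamma> k i l * J z $ l $ j))"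
      by (simp only: H_def left_diff_distrib sum_subtractf sum_distrib_right) (simp only: mult_ac)
    have "(\<Sum>k\<in>UNIV. du k * cov_deriv_endo \<Gamma> J z i k j) = (\<Sum>k\<in>UNIV. du k * dJ i k j)
        + (\<Sum>k\<in>UNIV. \<Sum>l\<in>UNIV. du k * (\<Gamma> k i l * J z $ l $ j))
        - (\<Sum>k\<in>UNIV. \<Sum>l\<in>UNIV. \<Gamma> l i j * (du k * J z $ k $ l))"
      by (simp add: cov_deriv_endo_def dJ_def ring_distribs sum_subtractf sum.distrib sum_distrib_left mult_ac)
    also have "(\<Sum>k\<in>UNIV. \<Sum>l\<in>UNIV. \<Gamma> l i j * (du k * J z $ k $ l)) = (\<Sum>l\<in>UNIV. \<Gamma> l i j * (\<Sum>k\<in>UNIV. du k * J z $ k $ l))"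
      by (subst sum.swap) (simp only: sum_distrib_left)
    also have "\<dots> = - r * (\<Sum>l\<in>UNIV. \<Gamma> l i j * du l)"
      by (simp add: eigen[OF z, folded du_def] sum_distrib_left sum_negf mult_ac)
    also have "(\<Sum>k\<in>UNIV. \<Sum>l\<in>UNIV. du k * (\<Gamma> k i l * J z $ l $ j)) =
        (\<Sum>l\<in>UNIV. \<Sum>k\<in>UNIV. du k * (\<Gamma> k i l * J z $ l $ j))"
      by (rule sum.swap)
    finally have 2: "(\<Sum>k\<in>UNIV. du k * cov_deriv_endo \<Gamma> J z i k j) = (\<Sum>k\<in>UNIV. du k * dJ i k j)
        + (\<Sum>l\<in>UNIV. \<Sum>k\<in>UNIV. du k * (\<Gamma> k i l * J z $ l $ j)) - - r * (\<Sum>l\<in>UNIV. \<Gamma> l i j * du l)" .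
    show ?thesis
      using diff[of i j] by (simp only: 1 2) (simp add: H_def right_diff_distrib)
  qed
  \<comment> \<open>Torsion-freeness and commuting partial derivatives make \<open>D du\<close>
    symmetric, so that its contraction with the skew \<open>J\<close> drops out of the trace of
    \<open>key\<close>.\<close>
  have "H i j = H j i" for i j
    using torsion[of _ i j] cpartial_commute[OF u z, of i j] by (simp add: H_def ddu_def)
  then have "trace_form G (\<lambda>i j. \<Sum>k\<in>UNIV. H i k * J z $ k $ j) = 0"
    by (rule trace_form_symmetric_J[OF G])
  moreover have "trace_form G (\<lambda>i j. \<Sum>k\<in>UNIV. du k * cov_deriv_endo \<Gamma> J z i k j)
      = (\<Sum>k\<in>UNIV. du k * trace_form G (\<lambda>i j. cov_deriv_endo \<Gamma> J z i k j))"
    by (simp add: trace_form_sum trace_form_scale)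
  moreover have "trace_form G (\<lambda>i j. (\<Sum>k\<in>UNIV. H i k * J z $ k $ j) + (\<Sum>k\<in>UNIV. du k * cov_deriv_endo \<Gamma> J z i k j))
      = - r * trace_form G H"
    by (simp only: key trace_form_scale)
  ultimately have "(\<Sum>k\<in>UNIV. du k * trace_form G (\<lambda>i j. cov_deriv_endo \<Gamma> J z i k j)) = - r * trace_form G H"
    by (simp add: trace_form_add)
  moreover have "H = (\<lambda>i j. cpartial i (cpartial j u) z - (\<Sum>k\<in>UNIV. \<Gamma> k i j * cpartial k u z))"
    by (simp add: fun_eq_iff du_def H_def ddu_def)
  ultimately show ?thesis by (simp only: du_def)
qed

text \<open>In dimension 2 a skew endomorphism is a multiple of \<open>J\<close>, and \<open>D\<^sub>i J\<close> is both skew and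
  anticommuting with \<open>J\<close>.\<close>
lemma cov_deriv_endo_dim2:
  fixes J g :: "complex^'m \<Rightarrow> complex^'m^'m"
  assumes dim: "CARD('m) = 2" and "open S" and z: "z \<in> S"
    and J: "\<And>k j. holo_fun (\<lambda>w. J w $ k $ j) T" and T: "S \<subseteq> T"
    and g: "\<And>k j. holo_fun (\<lambda>w. g w $ k $ j) S"
    and J2: "\<And>w. w \<in> S \<Longrightarrow> J w ** J w = - mat 1"
    and inv: "invertible (g z)"
    and gsym: "\<And>w. w \<in> S \<Longrightarrow> transpose (g w) = g w"
    and skew: "\<And>w. w \<in> S \<Longrightarrow> transpose (J w) ** g w = - (g w ** J w)"
    and conf: "\<And>p q. cov_deriv_metric \<Gamma> g z i p q = a * g z $ p $ q"
  shows "cov_deriv_endo \<Gamma> J z i k j = 0"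
proof -
  have "z \<in> T" using z T by blast
  define \<Gamma>i where "\<Gamma>i = (\<chi> k l. \<Gamma> k i l)"
  define dJ where "dJ = (\<chi> k j. cpartial i (\<lambda>w. J w $ k $ j) z)"
  define dg where "dg = (\<chi> k j. cpartial i (\<lambda>w. g w $ k $ j) z)"
  define A where "A = dJ + \<Gamma>i ** J z - J z ** \<Gamma>i"
  have A: "A $ k $ j = cov_deriv_endo \<Gamma> J z i k j" for k j
    by (simp add: A_def cov_deriv_endo_def dJ_def \<Gamma>i_def matrix_matrix_mult_def mult.commute)
  have dJ: "((\<lambda>t. J (z + axis i t) $ k $ j) has_field_derivative dJ $ k $ j) (at 0)" for k j
    using holo_fun_cpartial[OF J \<open>z \<in> T\<close>] by (simp add: dJ_def)
  have dg: "((\<lambda>t. g (z + axis i t) $ k $ j) has_field_derivative dg $ k $ j) (at 0)" for k j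
    using holo_fun_cpartial[OF g z] by (simp add: dg_def)
  \<comment> \<open>\<open>a\<close> is the value of the one-form in
    \<open>D g = \<alpha> \<otimes> g\<close> on the coordinate field \<open>i\<close>; as a scalar
    matrix it turns that condition into the matrix identity \<open>dg_eq\<close>.\<close>
  define aI :: "complex^'m^'m" where "aI = mat a"
  have aI: "aI ** B = B ** aI" for B
    by (simp add: aI_def matrix_matrix_mult_def mat_def vec_eq_iff mult_delta_left mult_delta_right mult.commute)
  have dg_eq: "dg = aI ** g z + transpose \<Gamma>i ** g z + g z ** \<Gamma>i"
  proof -
    have "dg $ p $ q = a * g z $ p $ q + (\<Sum>l\<in>UNIV. \<Gamma> l i p * g z $ l $ q) + (\<Sum>l\<in>UNIV. \<Gamma> l i q * g z $ p $ l)" for p q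
      using conf[of p q] by (simp add: dg_def cov_deriv_metric_def algebra_simps)
    then show ?thesis
      by (simp add: vec_eq_iff matrix_matrix_mult_def aI_def mat_def \<Gamma>i_def transpose_def
          mult_delta_left mult_delta_right mult.commute)
  qed
  have dprod: "((\<lambda>t. (B (z + axis i t) ** C (z + axis i t)) $ k $ j) has_field_derivative
      (dB ** C z + B z ** dC) $ k $ j) (at 0)"
    if dB: "\<And>k j. ((\<lambda>t. B (z + axis i t) $ k $ j) has_field_derivative dB $ k $ j) (at 0)"
      and dC: "\<And>k j. ((\<lambda>t. C (z + axis i t) $ k $ j) has_field_derivative dC $ k $ j) (at 0)"
    for B C :: "complex^'m \<Rightarrow> complex^'m^'m" and dB dC k j
  proof -
    have "((\<lambda>t. \<Sum>l\<in>UNIV. B (z + axis i t) $ k $ l * C (z + axis i t) $ l $ j) has_field_derivative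
      (\<Sum>l\<in>UNIV. dB $ k $ l * C (z + axis i 0) $ l $ j + dC $ l $ j * B (z + axis i 0) $ k $ l)) (at 0)"
      by (intro DERIV_sum DERIV_mult dB dC)
    then show ?thesis
      by (simp add: matrix_matrix_mult_def sum.distrib mult.commute)
  qed
  have dJ2: "dJ ** J z + J z ** dJ = 0"
  proof -
    have "(dJ ** J z + J z ** dJ) $ k $ j = 0" for k j
    proof (rule DERIV_line_unique[OF \<open>open S\<close> z _ dprod[of J, OF dJ dJ] DERIV_const])
      show "(J w ** J w) $ k $ j = (- mat 1) $ k $ j" if "w \<in> S" for w
        using J2[OF that] by simp
    qed
    then show ?thesis by (simp add: vec_eq_iff)
  qed
  \<comment> \<open>\<open>P\<close> is the matrix of the fundamental two-form
    \<open>g(X, J Y)\<close>, and \<open>dP\<close> its coordinate derivative in direction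
    \<open>i\<close>.\<close>
  define P where "P = g z ** J z"
  define dP where "dP = dg ** J z + g z ** dJ"
  have tP: "transpose P = - P"
    by (simp add: P_def matrix_transpose_mul gsym[OF z] skew[OF z])
  have tdP: "transpose dP = - dP"
  proof -
    have "dP $ k $ j = - dP $ j $ k" for k j
    proof (rule DERIV_line_unique[OF \<open>open S\<close> z])
      show "((\<lambda>t. (g (z + axis i t) ** J (z + axis i t)) $ k $ j) has_field_derivative dP $ k $ j) (at 0)"
        unfolding dP_def by (rule dprod[OF dg dJ])
      show "((\<lambda>t. - (g (z + axis i t) ** J (z + axis i t)) $ j $ k) has_field_derivative - dP $ j $ k) (at 0)"
        unfolding dP_def by (intro DERIV_minus dprod[OF dg dJ])
      fix w assume "w \<in> S"
      then have "transpose (g w ** J w) = - (g w ** J w)"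
        by (simp add: matrix_transpose_mul gsym skew)
      then have "transpose (g w ** J w) $ j $ k = - (g w ** J w) $ j $ k" by simp
      then show "(g w ** J w) $ k $ j = - (g w ** J w) $ j $ k"
        by (simp add: transpose_def)
    qed
    then show ?thesis unfolding transpose_eq_minus_iff by blast
  qed
  \<comment> \<open>By the Leibniz rule \<open>Q = g (D_i J)\<close> equals
    \<open>D_i P - a P\<close>. Transposition exchanges the two Christoffel terms up to sign, so
    \<open>Q\<close> is skew like \<open>P\<close>.\<close>
  define Q where "Q = g z ** A"
  have Q: "Q = dP - aI ** P - transpose \<Gamma>i ** P - P ** \<Gamma>i"
    by (simp add: Q_def A_def dP_def dg_eq P_def matrix_add_ldistrib matrix_add_rdistrib
        matrix_mul_diff matrix_mul_assoc)
  have "transpose aI = aI"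
    by (auto simp: aI_def mat_def transpose_def vec_eq_iff)
  then have tQ: "transpose Q = - Q"
    by (simp add: Q transpose_linear matrix_transpose_mul tP tdP matrix_mul_minus aI)
  obtain p q :: 'm where pq: "UNIV = {p, q}" "p \<noteq> q"
    using dim by (meson card_2_iff)
  have skew2: "B $ p $ p = 0 \<and> B $ q $ q = 0 \<and> B $ q $ p = - B $ p $ q"
    if "transpose B = - B" for B :: "complex^'m^'m"
  proof -
    have "B $ x $ y = - B $ y $ x" for x y
      using that unfolding transpose_eq_minus_iff by blast
    from this[of p p] this[of q q] this[of q p] show ?thesis by simp
  qed
  \<comment> \<open>Otherwise the skew matrix \<open>P\<close> would vanish, and with it
    \<open>J z\<close>, against \<open>J z ** J z = - mat 1\<close>.\<close>
  have "P $ p $ q \<noteq> 0"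
  proof
    assume "P $ p $ q = 0"
    then have "P $ x $ y = 0" for x y
      using skew2[OF tP] pq by (metis UNIV_I insertE minus_zero singletonD)
    then have "P = 0" by (simp add: vec_eq_iff)
    then have "matrix_inv (g z) ** g z ** (J z ** J z) = 0"
      by (simp add: P_def flip: matrix_mul_assoc) (simp add: matrix_mul_assoc)
    then have "- mat 1 = (0 :: complex^'m^'m)"
      by (simp add: J2[OF z] matrix_inv_mult(2)[OF inv] matrix_mul_minus)
    then have "(- mat 1 :: complex^'m^'m) $ p $ p = 0" by simp
    then show False by (simp add: mat_def)
  qed
  \<comment> \<open>A skew 2 by 2 matrix has one independent entry, so \<open>c\<close> is the
    factor with \<open>Q = c P\<close>, hence \<open>A = c J\<close>.\<close>
  define c where "c = Q $ p $ q / P $ p $ q"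
  have "Q $ x $ y = P $ x $ y * c" for x y
  proof -
    have "x \<in> {p, q}" "y \<in> {p, q}" using pq by auto
    then show ?thesis
      using skew2[OF tP] skew2[OF tQ] \<open>P $ p $ q \<noteq> 0\<close> by (auto simp: c_def)
  qed
  then have "Q = P ** mat c"
    by (simp add: vec_eq_iff matrix_matrix_mult_def mat_def mult_delta_right)
  then have "matrix_inv (g z) ** g z ** A = matrix_inv (g z) ** g z ** (J z ** mat c)"
    by (simp add: Q_def P_def flip: matrix_mul_assoc)
  then have "A = J z ** mat c"
    by (simp add: matrix_inv_mult(2)[OF inv])
  then have Ac: "A $ x $ y = J z $ x $ y * c" for x y
    by (simp add: matrix_matrix_mult_def mat_def mult_delta_right)
  \<comment> \<open>The Christoffel terms cancel because \<open>J z ** J z\<close> is scalar. By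
    \<open>dJ2\<close> the right side is zero, whereas \<open>A = c J\<close> makes the left side
    \<open>- 2 c\<close> times the identity.\<close>
  have "A ** J z + J z ** A = dJ ** J z + J z ** dJ"
    by (simp add: A_def matrix_add_ldistrib matrix_add_rdistrib matrix_mul_diff J2[OF z] matrix_mul_minus
        flip: matrix_mul_assoc) (simp add: matrix_mul_assoc J2[OF z] matrix_mul_minus)
  then have "(A ** J z) $ p $ p + (J z ** A) $ p $ p = 0"
    using dJ2 by (metis vector_add_component zero_index)
  moreover have "(A ** J z) $ p $ p = (J z ** J z) $ p $ p * c" "(J z ** A) $ p $ p = (J z ** J z) $ p $ p * c"
    by (simp_all add: matrix_matrix_mult_def Ac sum_distrib_left sum_distrib_right mult_ac)
  ultimately have "c = 0"
    by (simp add: J2[OF z] mat_def)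
  then show ?thesis using A Ac by (metis mult_zero_right)
qed

section \<open>Harmonicity on almost Hermitian manifolds\<close>

lemma cinv_coord:
  assumes "is_chart T \<kappa>" "p \<in> cdom \<kappa>"
  shows "cinv \<kappa> (coord \<kappa> p) = p"
proof -
  have "topspace (subtopology T (cdom \<kappa>)) = cdom \<kappa>"
    using assms(1) openin_subset[of T "cdom \<kappa>"] by (auto simp: is_chart_def)
  then have "inj_on (coord \<kappa>) (cdom \<kappa>)"
    using assms(1) homeomorphic_imp_injective_map unfolding is_chart_def by metis
  then show ?thesis using assms(2) by (simp add: cinv_def)
qed

lemma open_coord_image:
  assumes "is_chart T \<kappa>" "openin T V"
  shows "open (coord \<kappa> ` (cdom \<kappa> \<inter> V))"
proof -
  have "openin (top_of_set (coord \<kappa> ` cdom \<kappa>)) (coord \<kappa> ` (cdom \<kappa> \<inter> V))"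
    using assms homeomorphic_imp_open_map[of "subtopology T (cdom \<kappa>)"]
    unfolding is_chart_def open_map_def by (metis inf_commute openin_subtopology_Int)
  then show ?thesis
    using assms(1) by (simp add: is_chart_def openin_open_eq)
qed

lemma complex_manifold_chart:
  assumes "complex_manifold M" "p \<in> pts M"
  obtains \<kappa> where "\<kappa> \<in> atlas M" "p \<in> cdom \<kappa>"
  using assms unfolding complex_manifold_def by blast

lemma has_derivative_holo_comp:
  assumes F: "holo_vec F S" "w \<in> S" and h: "holo_fun h T" "F w \<in> T"
  shows "(h \<circ> F has_derivative
    (\<lambda>v. \<Sum>i\<in>UNIV. (\<Sum>b\<in>UNIV. cpartial b h (F w) * cpartial i (\<lambda>x. F x $ b) w) * v $ i)) (at w)"
proof -
  have "((\<lambda>x. F x $ b) has_derivative (\<lambda>v. \<Sum>i\<in>UNIV. cpartial i (\<lambda>x. F x $ b) w * v $ i)) (at w)" for b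
    using F by (intro holo_fun_has_derivative[of _ S]) (auto simp: holo_vec_def)
  then have "(F has_derivative (\<lambda>v. \<chi> b. \<Sum>i\<in>UNIV. cpartial i (\<lambda>x. F x $ b) w * v $ i)) (at w)"
    by (subst has_derivative_componentwise_within) (auto simp: Basis_vec_def inner_axis intro!: has_derivative_inner_left)
  from has_derivative_compose[OF this holo_fun_has_derivative[OF h]]
  have "((\<lambda>x. h (F x)) has_derivative (\<lambda>v. \<Sum>b\<in>UNIV. cpartial b h (F w) *
      (\<Sum>i\<in>UNIV. cpartial i (\<lambda>x. F x $ b) w * v $ i))) (at w)"
    by simp
  also have "(\<lambda>v. \<Sum>b\<in>UNIV. cpartial b h (F w) * (\<Sum>i\<in>UNIV. cpartial i (\<lambda>x. F x $ b) w * v $ i)) =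
      (\<lambda>v. \<Sum>i\<in>UNIV. (\<Sum>b\<in>UNIV. cpartial b h (F w) * cpartial i (\<lambda>x. F x $ b) w) * v $ i)"
    by (simp only: sum_distrib_left sum_distrib_right, subst sum.swap) (simp only: mult.assoc)
  finally show ?thesis by (simp only: comp_def)
qed

section \<open>Almost Hermitian structures in a chart\<close>

lemma almost_hermitian_at:
  assumes AH: "almost_hermitian M c J" and Wg: "(W, g) \<in> c" and \<kappa>: "\<kappa> \<in> atlas M"
    and z: "z \<in> coord \<kappa> ` (cdom \<kappa> \<inter> W)"
  shows "invertible (g \<kappa> z)" "transpose (g \<kappa> z) = g \<kappa> z"
    "transpose (J \<kappa> z) ** g \<kappa> z = - (g \<kappa> z ** J \<kappa> z)"
proof -
  have "local_metric M W g"
    using AH Wg by (auto simp: almost_hermitian_def conformal_manifold_def)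
  then show "invertible (g \<kappa> z)" "transpose (g \<kappa> z) = g \<kappa> z"
    using \<kappa> z by (auto simp: local_metric_def)
  show "transpose (J \<kappa> z) ** g \<kappa> z = - (g \<kappa> z ** J \<kappa> z)"
    by (rule hermitian_skew) (use AH Wg \<kappa> z in \<open>auto simp: almost_hermitian_def\<close>)
qed

lemma almost_hermitian_J:
  assumes AH: "almost_hermitian M c J" and \<kappa>: "\<kappa> \<in> atlas M"
  shows "holo_fun (\<lambda>w. J \<kappa> w $ k $ j) (coord \<kappa> ` cdom \<kappa>)"
    and "z \<in> coord \<kappa> ` cdom \<kappa> \<Longrightarrow> J \<kappa> z ** J \<kappa> z = - mat 1"
  using assms by (auto simp: almost_hermitian_def endo_field_def holo_mat_def)

text \<open>The dimension is even and positive, so \<open>D4\<close> and \<open>D2\<close> cover all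
  cases. From dimension 4 on the trace condition is part of \<open>hermitian_weyl\<close>; in
  dimension 2 even \<open>DJ\<close> vanishes for every Weyl connection.\<close>

lemma trace_DJ_eq_0:
  fixes M :: "('a, 'm::finite) cmfd"
  assumes AH: "almost_hermitian M c J" and Wg: "(W, g) \<in> c" and \<kappa>: "\<kappa> \<in> atlas M"
    and z: "z \<in> coord \<kappa> ` (cdom \<kappa> \<inter> W)"
    and D4: "CARD('m) \<ge> 4 \<Longrightarrow> hermitian_weyl M c J D" and D2: "CARD('m) = 2 \<Longrightarrow> weyl_space M c D"
  shows "D \<kappa> z k i j = D \<kappa> z k j i"
    and "trace_form (g \<kappa> z) (\<lambda>i j. cov_deriv_endo (D \<kappa> z) (J \<kappa>) z i k j) = 0"
proof -
  have zc: "z \<in> coord \<kappa> ` cdom \<kappa>" using z by blast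
  have "even CARD('m)"
    by (rule hermitian_even_dim[OF almost_hermitian_at(1,2)[OF AH Wg \<kappa> z]
          almost_hermitian_J(2)[OF AH \<kappa> zc] almost_hermitian_at(3)[OF AH Wg \<kappa> z]])
  moreover have "CARD('m) > 0" by simp
  ultimately have "CARD('m) = 2 \<or> CARD('m) \<ge> 4" by presburger
  then consider "CARD('m) = 2" | "CARD('m) \<ge> 4" by blast
  note cases = this
  from cases have weyl: "weyl_space M c D"
    using D4 D2 by (auto simp: hermitian_weyl_def)
  then show "D \<kappa> z k i j = D \<kappa> z k j i"
    using \<kappa> zc by (auto simp: weyl_space_def torsion_free_def)
  show "trace_form (g \<kappa> z) (\<lambda>i j. cov_deriv_endo (D \<kappa> z) (J \<kappa>) z i k j) = 0"
  proof (cases rule: cases)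
    case 1
    have lm: "local_metric M W g"
      using AH Wg by (auto simp: almost_hermitian_def conformal_manifold_def)
    then have g: "holo_fun (\<lambda>w. g \<kappa> w $ p $ q) (coord \<kappa> ` (cdom \<kappa> \<inter> W))" for p q
      using \<kappa> by (auto simp: local_metric_def holo_mat_def)
    then have op: "open (coord \<kappa> ` (cdom \<kappa> \<inter> W))" by (auto simp: holo_fun_def)
    have "cov_deriv_endo (D \<kappa> z) (J \<kappa>) z i k j = 0" for i j
    proof -
      obtain a where "cov_deriv_metric (D \<kappa> z) (g \<kappa>) z i p q = a * g \<kappa> z $ p $ q" for p q
        using weyl Wg \<kappa> z unfolding weyl_space_def preserves_conf_def by fast
      then show ?thesis
        using almost_hermitian_at[OF AH Wg \<kappa>] almost_hermitian_J[OF AH \<kappa>] z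
        by (intro cov_deriv_endo_dim2[OF 1 op z, where T = "coord \<kappa> ` cdom \<kappa>" and g = "g \<kappa>"] g) auto
    qed
    then show ?thesis by (simp add: trace_form_def)
  next
    case 2
    then show ?thesis using D4 Wg \<kappa> z unfolding hermitian_weyl_def by fast
  qed
qed

text \<open>The codomain enters the second fundamental form through products of differentials of
  components of \<open>\<phi>\<close>, whose traces vanish by
  \<open>trace_form_eigen_covectors\<close>; what remains is the Hessian of one component.
  \<open>U\<close> is the whole manifold in the direct part and the domain of a local submersion in
  the converse.\<close>

lemma trace_second_fund:
  assumes AH: "almost_hermitian M c J" and torsion: "\<And>k i j. D \<kappa> z k i j = D \<kappa> z k j i"
    and Wg: "(W, g) \<in> c" and \<kappa>: "\<kappa> \<in> atlas M" and \<mu>: "\<mu> \<in> atlas N"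
    and \<phi>: "holo_map U M N \<phi>" and z: "z \<in> rep_dom (U \<inter> W) \<kappa> \<mu> \<phi>" and r: "r * r = -1"
    and ker: "\<And>w. w \<in> rep_dom U \<kappa> \<mu> \<phi> \<Longrightarrow> eigendist J r \<kappa> w \<subseteq> ker_d \<kappa> \<mu> \<phi> w"
  shows "(\<Sum>k\<in>UNIV. cpartial k (\<lambda>w. coord_rep \<kappa> \<mu> \<phi> w $ a) z *
      trace_form (g \<kappa> z) (\<lambda>i j. cov_deriv_endo (D \<kappa> z) (J \<kappa>) z i k j))
    = - r * trace_form (g \<kappa> z) (second_fund (D \<kappa> z) \<Gamma>' (coord_rep \<kappa> \<mu> \<phi>) z a)"
proof -
  let ?F = "coord_rep \<kappa> \<mu> \<phi>" and ?S = "rep_dom U \<kappa> \<mu> \<phi>" and ?G = "g \<kappa> z"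
  have zS: "z \<in> ?S" and zW: "z \<in> coord \<kappa> ` (cdom \<kappa> \<inter> W)" and S: "?S \<subseteq> coord \<kappa> ` cdom \<kappa>"
    using z by (auto simp: rep_dom_def)
  have F: "holo_fun (\<lambda>w. ?F w $ b) ?S" for b
    using \<phi> \<kappa> \<mu> by (auto simp: holo_map_def holo_vec_def)
  have ann: "(\<Sum>k\<in>UNIV. cpartial k (\<lambda>w. ?F w $ b) w * v $ k) = 0" if "w \<in> ?S" "J \<kappa> w *v v = r *s v" for w v b
  proof -
    have "jac ?F w *v v = 0"
      using ker[OF that(1)] that(2) by (auto simp: eigendist_def ker_d_def)
    then have "(jac ?F w *v v) $ b = 0" by simp
    then show ?thesis by (simp add: jac_def matrix_vector_mult_def)
  qed
  note at = almost_hermitian_at[OF AH Wg \<kappa> zW] and J = almost_hermitian_J[OF AH \<kappa>]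
  have "r \<noteq> 0" using r by auto
  have "z \<in> coord \<kappa> ` cdom \<kappa>" using zS S by blast
  then have eigen: "(\<Sum>k\<in>UNIV. cpartial k (\<lambda>w. ?F w $ b) z * J \<kappa> z $ k $ j) = - r * cpartial j (\<lambda>w. ?F w $ b) z" for b j
    by (intro covector_eigen J r ann zS)
  have quad: "trace_form ?G (\<lambda>i j. cpartial i (\<lambda>w. ?F w $ b) z * cpartial j (\<lambda>w. ?F w $ b') z) = 0" for b b'
    by (rule trace_form_eigen_covectors[OF at(1,3) \<open>r \<noteq> 0\<close> eigen eigen])
  have "trace_form ?G (\<lambda>i j. \<Sum>b\<in>UNIV. \<Sum>c\<in>UNIV.
      \<Gamma>' a b c * (cpartial i (\<lambda>w. ?F w $ b) z * cpartial j (\<lambda>w. ?F w $ c) z)) = 0"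
    by (simp add: trace_form_sum trace_form_scale quad)
  then have hess: "trace_form ?G (second_fund (D \<kappa> z) \<Gamma>' ?F z a) =
      trace_form ?G (\<lambda>i j. cpartial i (cpartial j (\<lambda>w. ?F w $ a)) z
        - (\<Sum>k\<in>UNIV. D \<kappa> z k i j * cpartial k (\<lambda>w. ?F w $ a) z))"
    by (simp add: second_fund_def[abs_def] trace_form_add mult.assoc)
  show ?thesis
    unfolding hess
    by (rule trace_hessian_eigen_covector[OF F zS J(1) S J(2)[OF subsetD[OF S]] r at ann torsion])
qed

section \<open>The direct part: harmonic maps and harmonic morphisms\<close>

lemma harmonic_map_eigendist:
  fixes M :: "('a, 'm::finite) cmfd"
  assumes AH: "almost_hermitian M c J"
    and D4: "CARD('m) \<ge> 4 \<Longrightarrow> hermitian_weyl M c J D" and D2: "CARD('m) = 2 \<Longrightarrow> weyl_space M c D"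
    and \<phi>: "holo_map (pts M) M N \<phi>" and r: "r * r = -1" and ker: "ker_contains M N \<phi> (eigendist J r)"
  shows "harmonic_map (pts M) M c D N D' \<phi>"
proof -
  have "trace_form (g \<kappa> z) (second_fund (D \<kappa> z) \<Gamma>' (coord_rep \<kappa> \<mu> \<phi>) z a) = 0"
    if "(W, g) \<in> c" "\<kappa> \<in> atlas M" "\<mu> \<in> atlas N" "z \<in> rep_dom (pts M \<inter> W) \<kappa> \<mu> \<phi>" for W g \<kappa> \<mu> z a \<Gamma>'
  proof -
    have zW: "z \<in> coord \<kappa> ` (cdom \<kappa> \<inter> W)" using that(4) by (auto simp: rep_dom_def)
    have ker': "eigendist J r \<kappa> w \<subseteq> ker_d \<kappa> \<mu> \<phi> w" if "w \<in> rep_dom (pts M) \<kappa> \<mu> \<phi>" for w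
      using ker \<open>\<kappa> \<in> atlas M\<close> \<open>\<mu> \<in> atlas N\<close> that by (auto simp: ker_contains_def)
    have torsion: "D \<kappa> z k i j = D \<kappa> z k j i" for k i j
      by (rule trace_DJ_eq_0(1)[OF AH that(1,2) zW D4 D2])
    note * = trace_second_fund[where D = D, OF AH torsion that(1-3) \<phi> that(4) r ker',
        of a \<Gamma>']
    have zero: "trace_form (g \<kappa> z) (\<lambda>i j. cov_deriv_endo (D \<kappa> z) (J \<kappa>) z i k j) = 0" for k
      by (rule trace_DJ_eq_0(2)[OF AH that(1,2) zW D4 D2])
    have "r \<noteq> 0" using r by auto
    with * show ?thesis unfolding zero by simp
  qed
  then show ?thesis
    using \<phi> unfolding harmonic_map_def Let_def by blast
qed

text \<open>The chain rule through a chart \<open>\<mu>\<close> around \<open>\<phi> p\<close>. The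
  second conclusion places \<open>w\<close> where \<open>ker_contains\<close> can be
  applied.\<close>

lemma has_derivative_pullback:
  assumes M: "complex_manifold M" and N: "complex_manifold N" and \<phi>: "holo_map (pts M) M N \<phi>"
    and \<kappa>: "\<kappa> \<in> atlas M" and \<mu>: "\<mu> \<in> atlas N" and "openin (mtop N) V"
    and f: "holo_fun (f \<circ> cinv \<mu>) (coord \<mu> ` (cdom \<mu> \<inter> V))"
    and p: "p \<in> cdom \<kappa>" "\<phi> p \<in> cdom \<mu>" "\<phi> p \<in> V"
  defines "w \<equiv> coord \<kappa> p"
  shows "(f \<circ> \<phi> \<circ> cinv \<kappa> has_derivative (\<lambda>v. \<Sum>i\<in>UNIV.
      (\<Sum>b\<in>UNIV. cpartial b (f \<circ> cinv \<mu>) (coord_rep \<kappa> \<mu> \<phi> w) *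
        cpartial i (\<lambda>x. coord_rep \<kappa> \<mu> \<phi> x $ b) w) * v $ i)) (at w)"
    and "w \<in> rep_dom (pts M) \<kappa> \<mu> \<phi>"
proof -
  have ch: "is_chart (mtop M) \<kappa>" "is_chart (mtop N) \<mu>"
    using M N \<kappa> \<mu> by (auto simp: complex_manifold_def)
  have "cdom \<kappa> \<subseteq> pts M" using ch(1) openin_subset by (auto simp: is_chart_def)
  with p show w: "w \<in> rep_dom (pts M) \<kappa> \<mu> \<phi>"
    by (auto simp: rep_dom_def w_def)
  have F: "holo_vec (coord_rep \<kappa> \<mu> \<phi>) (rep_dom (pts M) \<kappa> \<mu> \<phi>)"
    using \<phi> \<kappa> \<mu> by (simp add: holo_map_def)
  then have op: "open (rep_dom (pts M) \<kappa> \<mu> \<phi>)"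
    by (simp add: holo_vec_def holo_fun_def)
  have Fw: "coord_rep \<kappa> \<mu> \<phi> w \<in> coord \<mu> ` (cdom \<mu> \<inter> V)"
    using p by (simp add: coord_rep_def w_def cinv_coord[OF ch(1)])
  show "(f \<circ> \<phi> \<circ> cinv \<kappa> has_derivative (\<lambda>v. \<Sum>i\<in>UNIV.
      (\<Sum>b\<in>UNIV. cpartial b (f \<circ> cinv \<mu>) (coord_rep \<kappa> \<mu> \<phi> w) *
        cpartial i (\<lambda>x. coord_rep \<kappa> \<mu> \<phi> x $ b) w) * v $ i)) (at w)"
  \<comment> \<open>\<open>cinv \<mu>\<close> is known to undo \<open>coord \<mu>\<close> only on
    \<open>cdom \<mu>\<close>, so the two functions are compared on the open set
    \<open>rep_dom\<close>, which contains \<open>w\<close>.\<close>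
  proof (rule has_derivative_transform_within_open[OF has_derivative_holo_comp[OF F w f Fw] op w])
    fix x assume "x \<in> rep_dom (pts M) \<kappa> \<mu> \<phi>"
    then obtain q where q: "q \<in> cdom \<kappa>" "\<phi> q \<in> cdom \<mu>" "x = coord \<kappa> q"
      by (auto simp: rep_dom_def)
    then show "((f \<circ> cinv \<mu>) \<circ> coord_rep \<kappa> \<mu> \<phi>) x = (f \<circ> \<phi> \<circ> cinv \<kappa>) x"
      by (simp add: coord_rep_def cinv_coord[OF ch(1)] cinv_coord[OF ch(2)])
  qed
qed

text \<open>The differential of \<open>f \<circ> \<phi>\<close> factors through
  \<open>d\<phi>\<close> and so vanishes on the \<open>r\<close>-eigenspaces. Hence
  \<open>trace_hessian_eigen_covector\<close> applies to \<open>f \<circ> \<phi>\<close> itself,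
  without a composition formula for second derivatives.\<close>

lemma harmonic_morphism_eigendist:
  fixes M :: "('a, 'm::finite) cmfd"
  assumes AH: "almost_hermitian M c J" and N: "complex_manifold N"
    and D4: "CARD('m) \<ge> 4 \<Longrightarrow> hermitian_weyl M c J D" and D2: "CARD('m) = 2 \<Longrightarrow> weyl_space M c D"
    and \<phi>: "holo_map (pts M) M N \<phi>" and r: "r * r = -1" and ker: "ker_contains M N \<phi> (eigendist J r)"
  shows "harmonic_morphism M c D N c' D' \<phi>"
  unfolding harmonic_morphism_def
proof (intro conjI allI impI)
  have M: "complex_manifold M"
    using AH by (simp add: almost_hermitian_def conformal_manifold_def)
  fix V f assume harm: "harmonic_fun V N c' D' f"
  then have V: "openin (mtop N) V" and f: "\<And>\<mu>. \<mu> \<in> atlas N \<Longrightarrow> holo_fun (f \<circ> cinv \<mu>) (coord \<mu> ` (cdom \<mu> \<inter> V))"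
    by (auto simp: harmonic_fun_def)
  define U where "U = {p \<in> pts M. \<phi> p \<in> V}"
  have U: "openin (mtop M) U"
    using \<phi> V openin_continuous_map_preimage unfolding holo_map_def U_def by fastforce
  \<comment> \<open>The chart \<open>\<mu>\<close> depends on the point, so the differential is
    recorded as an unnamed covector; differentiability gives \<open>holo\<close>, and the vanishing
    on eigenvectors gives \<open>ann\<close>.\<close>
  have point: "\<exists>a. (f \<circ> \<phi> \<circ> cinv \<kappa> has_derivative (\<lambda>v. \<Sum>i\<in>UNIV. a $ i * v $ i)) (at w) \<and>
      (\<forall>v. J \<kappa> w *v v = r *s v \<longrightarrow> (\<Sum>i\<in>UNIV. a $ i * v $ i) = 0)"
    if \<kappa>: "\<kappa> \<in> atlas M" and w: "w \<in> coord \<kappa> ` (cdom \<kappa> \<inter> U)" for \<kappa> w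
  proof -
    obtain p where p: "p \<in> cdom \<kappa>" "\<phi> p \<in> V" "w = coord \<kappa> p" using w by (auto simp: U_def)
    have "\<phi> p \<in> pts N" using p(2) openin_subset[OF V] by blast
    then obtain \<mu> where \<mu>: "\<mu> \<in> atlas N" "\<phi> p \<in> cdom \<mu>"
      using complex_manifold_chart[OF N] by blast
    let ?F = "coord_rep \<kappa> \<mu> \<phi>"
    let ?h = "\<lambda>b. cpartial b (f \<circ> cinv \<mu>) (?F w)"
    define a :: "complex^'m" where "a = (\<chi> i. \<Sum>b\<in>UNIV. ?h b * cpartial i (\<lambda>x. ?F x $ b) w)"
    note der = has_derivative_pullback[OF M N \<phi> \<kappa> \<mu>(1) V f[OF \<mu>(1)] p(1) \<mu>(2) p(2), folded p(3)]
    have "(\<Sum>i\<in>UNIV. a $ i * v $ i) = 0" if "J \<kappa> w *v v = r *s v" for v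
    proof -
      have "jac ?F w *v v = 0"
        using ker \<kappa> \<mu>(1) der(2) that by (fastforce simp: ker_contains_def eigendist_def ker_d_def)
      then have zero: "(\<Sum>i\<in>UNIV. cpartial i (\<lambda>x. ?F x $ b) w * v $ i) = 0" for b
        by (simp add: jac_def matrix_vector_mult_def vec_eq_iff)
      have "(\<Sum>i\<in>UNIV. a $ i * v $ i) = (\<Sum>b\<in>UNIV. ?h b * (\<Sum>i\<in>UNIV. cpartial i (\<lambda>x. ?F x $ b) w * v $ i))"
        by (simp only: a_def vec_lambda_beta sum_distrib_left sum_distrib_right, subst sum.swap)
          (simp only: mult.assoc)
      then show ?thesis by (simp only: zero) simp
    qed
    with der(1) show ?thesis by (intro exI[of _ a]) (simp add: a_def)
  qed
  have holo: "holo_fun (f \<circ> \<phi> \<circ> cinv \<kappa>) (coord \<kappa> ` (cdom \<kappa> \<inter> U))" if "\<kappa> \<in> atlas M" for \<kappa>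
    using point[OF that] open_coord_image[OF _ U, of \<kappa>] M that
    unfolding holo_fun_def complex_manifold_def by blast
  have "trace_form (g \<kappa> z) (\<lambda>i j. cpartial i (cpartial j (f \<circ> \<phi> \<circ> cinv \<kappa>)) z
      - (\<Sum>k\<in>UNIV. D \<kappa> z k i j * cpartial k (f \<circ> \<phi> \<circ> cinv \<kappa>) z)) = 0"
    (is "?T = 0") if Wg: "(W, g) \<in> c" and \<kappa>: "\<kappa> \<in> atlas M" and z: "z \<in> coord \<kappa> ` (cdom \<kappa> \<inter> W \<inter> U)" for W g \<kappa> z
  proof -
    have zW: "z \<in> coord \<kappa> ` (cdom \<kappa> \<inter> W)" and zU: "z \<in> coord \<kappa> ` (cdom \<kappa> \<inter> U)" using z by auto
    have S: "coord \<kappa> ` (cdom \<kappa> \<inter> U) \<subseteq> coord \<kappa> ` cdom \<kappa>" by blast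
    have ann: "(\<Sum>i\<in>UNIV. cpartial i (f \<circ> \<phi> \<circ> cinv \<kappa>) w * v $ i) = 0"
      if "w \<in> coord \<kappa> ` (cdom \<kappa> \<inter> U)" "J \<kappa> w *v v = r *s v" for w v
      using point[OF \<kappa> that(1)] that(2) cpartial_eq by fastforce
    have torsion: "D \<kappa> z k i j = D \<kappa> z k j i" for k i j
      by (rule trace_DJ_eq_0(1)[OF AH Wg \<kappa> zW D4 D2])
    have zero: "trace_form (g \<kappa> z) (\<lambda>i j. cov_deriv_endo (D \<kappa> z) (J \<kappa>) z i k j) = 0" for k
      by (rule trace_DJ_eq_0(2)[OF AH Wg \<kappa> zW D4 D2])
    have "(\<Sum>k\<in>UNIV. cpartial k (f \<circ> \<phi> \<circ> cinv \<kappa>) z *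
        trace_form (g \<kappa> z) (\<lambda>i j. cov_deriv_endo (D \<kappa> z) (J \<kappa>) z i k j)) = - r * ?T"
      by (rule trace_hessian_eigen_covector[OF holo[OF \<kappa>] zU almost_hermitian_J(1)[OF AH \<kappa>] S
        almost_hermitian_J(2)[OF AH \<kappa> subsetD[OF S]] r almost_hermitian_at[OF AH Wg \<kappa> zW] ann torsion])
    moreover have "r \<noteq> 0" using r by auto
    ultimately show ?thesis by (simp only: zero) simp
  qed
  with U holo show "harmonic_fun {p \<in> pts M. \<phi> p \<in> V} M c D (f \<circ> \<phi>)"
    unfolding U_def[symmetric] harmonic_fun_def Let_def by blast
qed (rule \<phi>)

text \<open>Harmonicity of the local submersion makes the right side of
  \<open>trace_second_fund\<close> vanish, so \<open>d\<phi>\<close> kills the trace of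
  \<open>DJ\<close>; its kernel is the eigendistribution.\<close>

lemma trace_DJ_in_eigendist:
  assumes AH: "almost_hermitian M c J" and D: "weyl_space M c D"
    and loc: "locally_defined_by_harmonic_maps TYPE(('b, 'n::finite) cmfd) M c D (eigendist J r)"
    and r: "r * r = -1"
    and Wg: "(W, g) \<in> c" and \<kappa>: "\<kappa> \<in> atlas M" and z: "z \<in> coord \<kappa> ` (cdom \<kappa> \<inter> W)"
  shows "(\<chi> k. trace_form (g \<kappa> z) (\<lambda>i j. cov_deriv_endo (D \<kappa> z) (J \<kappa>) z i k j)) \<in> eigendist J r \<kappa> z"
    (is "?V \<in> _")
proof -
  have M: "complex_manifold M"
    using AH by (simp add: almost_hermitian_def conformal_manifold_def)
  have torsion: "D \<kappa> z k i j = D \<kappa> z k j i" for k i j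
    using D \<kappa> z by (auto simp: weyl_space_def torsion_free_def)
  obtain p where p: "p \<in> cdom \<kappa>" "p \<in> W" "z = coord \<kappa> p" using z by blast
  then have "p \<in> pts M" using M \<kappa> by (auto simp: complex_manifold_def)
  obtain U and N :: "('b, 'n) cmfd" and D' \<phi> where U: "p \<in> U" and N: "complex_manifold N"
    and sub: "submersion U M N \<phi>" and img: "\<phi> ` U = pts N"
    and ker: "\<forall>\<kappa>\<in>atlas M. \<forall>\<mu>\<in>atlas N. \<forall>z\<in>rep_dom U \<kappa> \<mu> \<phi>. eigendist J r \<kappa> z = ker_d \<kappa> \<mu> \<phi> z"
    and harm: "harmonic_map U M c D N D' \<phi>"
    using loc[unfolded locally_defined_by_harmonic_maps_def, THEN bspec, OF \<open>p \<in> pts M\<close>]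
    by (elim exE conjE) (rule that)
  obtain \<mu> where \<mu>: "\<mu> \<in> atlas N" "\<phi> p \<in> cdom \<mu>"
    using complex_manifold_chart[OF N] U img by blast
  let ?F = "coord_rep \<kappa> \<mu> \<phi>"
  have zS: "z \<in> rep_dom (U \<inter> W) \<kappa> \<mu> \<phi>" and zU: "z \<in> rep_dom U \<kappa> \<mu> \<phi>"
    using p U \<mu> by (auto simp: rep_dom_def)
  have "holo_map U M N \<phi>" using sub by (simp add: submersion_def)
  \<comment> \<open>The kernel premise stays open here and is discharged below by
    \<open>ker\<close>, whose equality gives the required inclusion.\<close>
  note trace_second_fund[where D = D and \<Gamma>' = "D' \<mu> (?F z)", OF AH torsion Wg \<kappa> \<mu>(1) this zS r]
  moreover have "trace_form (g \<kappa> z) (second_fund (D \<kappa> z) (D' \<mu> (?F z)) ?F z a) = 0" for a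
    using harm Wg \<kappa> \<mu>(1) zS unfolding harmonic_map_def Let_def by blast
  ultimately have "(\<Sum>k\<in>UNIV. cpartial k (\<lambda>w. ?F w $ a) z * ?V $ k) = 0" for a
    using ker \<kappa> \<mu>(1) by simp
  then have "?V \<in> ker_d \<kappa> \<mu> \<phi> z"
    by (simp add: ker_d_def jac_def matrix_vector_mult_def vec_eq_iff)
  then show ?thesis using ker \<kappa> \<mu>(1) zU by blast
qed

theorem proposition3p8:
  fixes M :: "('a, 'm::finite) cmfd"
    and c\<^sub>M :: "('a, 'm) conf"
    and J\<^sub>M :: "('a, 'm) mat_field"
  assumes "almost_hermitian M c\<^sub>M J\<^sub>M"
  shows
    "(\<forall>D\<^sub>M (N :: ('b, 'n::finite) cmfd) \<phi>.
        (CARD('m) \<ge> 4 \<longrightarrow> hermitian_weyl M c\<^sub>M J\<^sub>M D\<^sub>M) \<longrightarrow>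
        (CARD('m) = 2 \<longrightarrow> weyl_space M c\<^sub>M D\<^sub>M) \<longrightarrow>
        complex_manifold N \<longrightarrow>
        hor_conformal_degenerate M c\<^sub>M N \<phi> \<longrightarrow>
        ker_contains M N \<phi> (eigendist J\<^sub>M \<i>) \<or> ker_contains M N \<phi> (eigendist J\<^sub>M (-\<i>)) \<longrightarrow>
        (\<forall>D\<^sub>N. linear_connection N D\<^sub>N \<longrightarrow> harmonic_map (pts M) M c\<^sub>M D\<^sub>M N D\<^sub>N \<phi>) \<and>
        (\<forall>c\<^sub>N D\<^sub>N. weyl_space N c\<^sub>N D\<^sub>N \<longrightarrow> harmonic_morphism M c\<^sub>M D\<^sub>M N c\<^sub>N D\<^sub>N \<phi>))
     \<and>
     (\<forall>D. CARD('m) \<ge> 4 \<longrightarrow> integrable_structure M J\<^sub>M \<longrightarrow> weyl_space M c\<^sub>M D \<longrightarrow>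
        locally_defined_by_harmonic_maps TYPE(('c, 'k::finite) cmfd) M c\<^sub>M D (eigendist J\<^sub>M \<i>) \<longrightarrow>
        locally_defined_by_harmonic_maps TYPE(('d, 'l::finite) cmfd) M c\<^sub>M D (eigendist J\<^sub>M (-\<i>)) \<longrightarrow>
        hermitian_weyl M c\<^sub>M J\<^sub>M D)"
proof (intro conjI allI impI)
  fix D\<^sub>M and N :: "('b, 'n::finite) cmfd" and \<phi>
  assume D: "CARD('m) \<ge> 4 \<longrightarrow> hermitian_weyl M c\<^sub>M J\<^sub>M D\<^sub>M" "CARD('m) = 2 \<longrightarrow> weyl_space M c\<^sub>M D\<^sub>M"
    and N: "complex_manifold N" and \<phi>: "hor_conformal_degenerate M c\<^sub>M N \<phi>"
    and "ker_contains M N \<phi> (eigendist J\<^sub>M \<i>) \<or> ker_contains M N \<phi> (eigendist J\<^sub>M (-\<i>))"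
  \<comment> \<open>Both eigenvalues are square roots of -1, and the lemmas rely on nothing else
    about \<open>r\<close>.\<close>
  then obtain r :: complex where r: "r * r = -1" "ker_contains M N \<phi> (eigendist J\<^sub>M r)"
    by (metis i_squared minus_mult_minus)
  have holo: "holo_map (pts M) M N \<phi>"
    using \<phi> by (simp add: hor_conformal_degenerate_def submersion_def)
  show "harmonic_map (pts M) M c\<^sub>M D\<^sub>M N D\<^sub>N \<phi>" for D\<^sub>N
    using harmonic_map_eigendist[OF assms _ _ holo r] D by blast
  show "harmonic_morphism M c\<^sub>M D\<^sub>M N c\<^sub>N D\<^sub>N \<phi>" for c\<^sub>N D\<^sub>N
    using harmonic_morphism_eigendist[OF assms N _ _ holo r] D by blast
next
  fix D
  assume D: "weyl_space M c\<^sub>M D"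
    and loc: "locally_defined_by_harmonic_maps TYPE(('c, 'k::finite) cmfd) M c\<^sub>M D (eigendist J\<^sub>M \<i>)"
      "locally_defined_by_harmonic_maps TYPE(('d, 'l::finite) cmfd) M c\<^sub>M D (eigendist J\<^sub>M (-\<i>))"
  have "trace_form (g \<kappa> z) (\<lambda>i j. cov_deriv_endo (D \<kappa> z) (J\<^sub>M \<kappa>) z i k j) = 0"
    if "(W, g) \<in> c\<^sub>M" "\<kappa> \<in> atlas M" "z \<in> coord \<kappa> ` (cdom \<kappa> \<inter> W)" for W g \<kappa> z k
  proof -
    \<comment> \<open>\<open>V\<close> is the trace of \<open>DJ\<close> as a vector; it is an
      eigenvector for both \<open>\<i>\<close> and \<open>-\<i>\<close>, which forces it to
      vanish.\<close>
    define V where "V = (\<chi> k. trace_form (g \<kappa> z) (\<lambda>i j. cov_deriv_endo (D \<kappa> z) (J\<^sub>M \<kappa>) z i k j))"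
    have "J\<^sub>M \<kappa> z *v V = \<i> *s V" "J\<^sub>M \<kappa> z *v V = (-\<i>) *s V"
      using trace_DJ_in_eigendist[OF assms D loc(1) _ that] trace_DJ_in_eigendist[OF assms D loc(2) _ that]
      by (simp_all add: V_def eigendist_def)
    then have "\<i> *s V = (-\<i>) *s V" by simp
    then have "\<i> * V $ k = - \<i> * V $ k"
      by (metis vector_smult_component)
    then show ?thesis by (simp add: V_def)
  qed
  with D show "hermitian_weyl M c\<^sub>M J\<^sub>M D"
    unfolding hermitian_weyl_def by blast
qed

end
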